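(* Let $d\ge2$ and let $A$ be the signed adjacency matrix of an edge signing of a finite $d$-regular graph satisfying $r_A^2\le2(d-1)$. Then $$\rho(A)\le\sqrt{7d-8}<\sqrt7\,\sqrt{d-1}.$$
   Context: All graphs are finite, simple and undirected, with vertex set $[n]$, $n\ge1$. An edge signing of $G=(V,E)$ is a map $\sigma:E\to\{-1,+1\}$; its signed adjacency matrix is the real symmetric $n\times n$ matrix whose $(i,j)$ entry is $\sigma(\{i,j\})$ if $\{i,j\}\in E$ and $0$ otherwise. $\rho(A)=\|A\|_{\mathrm{op}}$ denotes the spectral radius of a symmetric matrix. For $S\subseteq[n]$, $A[S]$ is the principal submatrix indexed by $S$ (empty determinant equal to $1$). For a real symmetric zero-diagonal $n\times n$ matrix $A$, $r_A$ denotes the largest root of the (monic, real-rooted) mixed determinantal polynomial $$\chi[A,-A](x)=2^{-n}\sum_{S\subseteq[n]}\det(xI-A[S])\det(xI+A[[n]\setminus S]).$$ *)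

theory Defs
  imports
    "Jordan_Normal_Form.DL_Submatrix"
    "Jordan_Normal_Form.Char_Poly"
    "Jordan_Normal_Form.Spectral_Radius"
begin

text \<open>The vertex set \<open>[n]\<close> is rendered as \<open>{..<n}\<close>, matching the 0-based indices of the matrix library.\<close>

definition simple_graph :: "nat \<Rightarrow> nat set set \<Rightarrow> bool" where
  "simple_graph n E \<longleftrightarrow> (\<forall>e\<in>E. e \<subseteq> {..<n} \<and> card e = 2)"

definition regular_graph :: "nat \<Rightarrow> nat set set \<Rightarrow> nat \<Rightarrow> bool" where
  "regular_graph n E d \<longleftrightarrow> simple_graph n E \<and> (\<forall>i<n. card {e\<in>E. i \<in> e} = d)"

text \<open>Only the values of \<open>\<sigma>\<close> on \<open>E\<close> are constrained or used.\<close>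

definition edge_signing :: "nat set set \<Rightarrow> (nat set \<Rightarrow> real) \<Rightarrow> bool" where
  "edge_signing E \<sigma> \<longleftrightarrow> (\<forall>e\<in>E. \<sigma> e \<in> {-1, 1})"

definition signed_adjacency :: "nat \<Rightarrow> nat set set \<Rightarrow> (nat set \<Rightarrow> real) \<Rightarrow> real mat" where
  "signed_adjacency n E \<sigma> = mat n n (\<lambda>(i, j). if {i, j} \<in> E then \<sigma> {i, j} else 0)"

text \<open>\<open>spectral_radius\<close> is only available for complex matrices. For a symmetric real
  matrix the value below coincides with the Euclidean operator norm.\<close>

definition rho :: "real mat \<Rightarrow> real" where
  "rho A = spectral_radius (map_mat complex_of_real A)"

definition principal_submatrix :: "'a mat \<Rightarrow> nat set \<Rightarrow> 'a mat" where
  "principal_submatrix A S = submatrix A S S"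

text \<open>For \<open>n \<times> n\<close> matrices, \<open>char_poly (principal_submatrix B T)\<close> is \<open>det (x I - B[T])\<close>, which
  for \<open>B = - A\<close> is \<open>det (x I + A[T])\<close>; the determinant of the \<open>0 \<times> 0\<close> matrix is \<open>1\<close>.\<close>

definition mixed_det_poly :: "real mat \<Rightarrow> real mat \<Rightarrow> real poly" where
  "mixed_det_poly A B = (let V = {..<dim_row A} in
     smult (1 / 2 ^ dim_row A)
       (\<Sum>S\<in>Pow V. char_poly (principal_submatrix A S) * char_poly (principal_submatrix B (V - S))))"

text \<open>For \<open>n \<ge> 1\<close> and \<open>A\<close> symmetric with zero diagonal, \<open>mixed_det_poly A (- A)\<close> is monic of
  degree \<open>n\<close> and real-rooted, so the maximum is over a nonempty finite set.\<close>

definition largest_mixed_root :: "real mat \<Rightarrow> real" where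
  "largest_mixed_root A = Max {x. poly (mixed_det_poly A (- A)) x = 0}"

end

theory Submission
  imports Defs "HOL-Real_Asymp.Real_Asymp"
begin

text \<open>For \<open>S \<subseteq> [n]\<close> let \<open>X_S\<close> (\<open>signed_cut\<close>) be \<open>A\<close> on \<open>S\<close>, \<open>- A\<close> on the complement and zero across.
  Then \<open>2 ^ n * \<chi>[A, - A]\<close> is \<open>P(x) = (\<Sum>S. det (x I - X_S))\<close>. The multivariate version of this sum arises
  from \<open>det (Z - A) * det (Z + A)\<close> by differentiating once in every variable, so it has no zeros when
  all variables lie in the upper half-plane. Applied to \<open>A\<close> bordered by a real vector \<open>b\<close>, this shows
  that \<open>Q / P\<close> with \<open>Q(x) = (\<Sum>S. det (x I - X_S) * b\<^sup>T (x I - X_S)\<^sup>-\<^sup>1 b)\<close> maps the upper half-plane to the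
  closed lower one; hence \<open>Q(x) / P(x) = (\<Sum>s. c_s / (x - s))\<close> with \<open>c_s \<ge> 0\<close> and \<open>\<bar>s\<bar> \<le> r\<close>, where \<open>r = r_A\<close>.
  The expansion at infinity has second moment equal to the average of \<open>\<bar>X_S b\<bar>\<^sup>2\<close> over \<open>S\<close>, which is
  \<open>b\<^sup>T (A\<^sup>2 + diag (A\<^sup>2)) b / 4\<close>, and this is therefore at most \<open>r\<^sup>2 \<bar>b\<bar>\<^sup>2\<close>. For a signed \<open>d\<close>-regular graph
  the diagonal of \<open>A\<^sup>2\<close> is constantly \<open>d\<close>, so \<open>\<rho>(A)\<^sup>2 + d \<le> 4 r\<^sup>2 \<le> 8 (d - 1)\<close>.\<close>

section \<open>Principal minors\<close>

text \<open>The Leibniz formula over an arbitrary index set, so that minors on different subsets can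
  be split and compared without renumbering rows.\<close>

definition minor :: "('a \<Rightarrow> 'a \<Rightarrow> 'b::comm_ring_1) \<Rightarrow> 'a set \<Rightarrow> 'b" where
  "minor M S = (\<Sum>\<pi> | \<pi> permutes S. of_int (sign \<pi>) * (\<Prod>i\<in>S. M i (\<pi> i)))"

lemma minor_cong:
  assumes "\<And>i j. i \<in> S \<Longrightarrow> j \<in> S \<Longrightarrow> M i j = M' i j"
  shows "minor M S = minor M' S"
  unfolding minor_def by (intro sum.cong prod.cong arg_cong2[where f = "(*)"])
    (auto simp: assms permutes_in_image)

lemma minor_uminus: "minor (\<lambda>i j. - M i j) S = (-1) ^ card S * minor M S"
  unfolding minor_def by (simp add: prod_uminus sum_distrib_left mult_ac)

lemma (in comm_ring_hom) hom_minor: "hom (minor M S) = minor (\<lambda>i j. hom (M i j)) S"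
proof -
  have "hom (of_int (sign \<pi>)) = of_int (sign \<pi>)" for \<pi> :: "'c \<Rightarrow> 'c"
    by (simp add: sign_def hom_uminus)
  then show ?thesis
    by (simp add: minor_def hom_distribs)
qed

lemma poly_minor: "poly (minor M S) x = minor (\<lambda>i j. poly (M i j) x) S"
proof -
  have "poly (of_int (sign \<pi>)) x = of_int (sign \<pi>)" for \<pi> :: "'b \<Rightarrow> 'b"
    by (simp add: sign_def)
  then show ?thesis
    by (simp add: minor_def poly_sum poly_prod)
qed

text \<open>Permutations fixing \<open>k\<close> are those of \<open>S\<close> and give the first
  summand. The others never use the diagonal entry at \<open>k\<close>, so setting it to 0 keeps
  them and kills the fixing ones.\<close>

lemma minor_insert:
  assumes "finite S" "k \<notin> S"
  shows "minor M (insert k S) = M k k * minor M S + minor (M(k := (M k)(k := 0))) (insert k S)"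
proof -
  let ?P = "{\<pi>. \<pi> permutes insert k S}" and ?Q = "{\<pi>. \<pi> permutes S}"
  let ?N = "M(k := (M k)(k := 0))"
  let ?t = "\<lambda>M \<pi>. of_int (sign \<pi>) * (\<Prod>i\<in>insert k S. M i (\<pi> i))"
  have fin: "finite ?P" using assms finite_permutations by blast
  have sub: "?Q \<subseteq> ?P" using permutes_subset by blast
  have fix_iff: "\<pi> \<in> ?Q \<longleftrightarrow> \<pi> k = k" if "\<pi> \<in> ?P" for \<pi>
    using that assms permutes_superset[of \<pi> "insert k S" S] by (auto simp: permutes_not_in)
  have "minor M (insert k S) = (\<Sum>\<pi>\<in>?Q. ?t M \<pi>) + (\<Sum>\<pi>\<in>?P - ?Q. ?t M \<pi>)"
    unfolding minor_def using sum.subset_diff[OF sub fin] by (simp add: add.commute)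
  also have "(\<Sum>\<pi>\<in>?Q. ?t M \<pi>) = M k k * minor M S"
    unfolding minor_def sum_distrib_left
    by (intro sum.cong) (use assms in \<open>auto simp: permutes_not_in mult_ac\<close>)
  also have "(\<Sum>\<pi>\<in>?P - ?Q. ?t M \<pi>) = (\<Sum>\<pi>\<in>?P - ?Q. ?t ?N \<pi>)"
    by (intro sum.cong arg_cong2[where f = "(*)"] prod.cong refl) (use fix_iff in auto)
  also have "\<dots> = minor ?N (insert k S)"
    unfolding minor_def
  proof (intro sum.mono_neutral_left fin ballI)
    fix \<pi> assume "\<pi> \<in> ?P - (?P - ?Q)"
    then have "?N k (\<pi> k) = 0" using fix_iff by auto
    then show "?t ?N \<pi> = 0" using assms by simp
  qed auto
  finally show ?thesis .
qed

text \<open>Conjugation by \<open>f\<close> is a sign-preserving bijection between the permutations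
  of \<open>A\<close> and those of its image.\<close>

lemma minor_reindex:
  assumes "finite A" "inj_on f A"
  shows "minor (\<lambda>i j. M (f i) (f j)) A = minor M (f ` A)"
proof -
  let ?m = "map_permutation A f"
  have b: "bij_betw f A (f ` A)" using assms by (simp add: bij_betw_def)
  have "bij_betw ?m {\<pi>. \<pi> permutes A} {\<pi>. \<pi> permutes f ` A}"
  proof (rule bij_betwI[where g = "map_permutation (f ` A) (inv_into A f)"])
    show "?m \<in> {\<pi>. \<pi> permutes A} \<rightarrow> {\<pi>. \<pi> permutes f ` A}"
      using map_permutation_permutes[OF b] by auto
    show "map_permutation (f ` A) (inv_into A f) \<in> {\<pi>. \<pi> permutes f ` A} \<rightarrow> {\<pi>. \<pi> permutes A}"
      using map_permutation_permutes[OF bij_betw_inv_into[OF b]] by auto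
    show "map_permutation (f ` A) (inv_into A f) (?m \<pi>) = \<pi>" if "\<pi> \<in> {\<pi>. \<pi> permutes A}" for \<pi>
      using that assms by (intro map_permutation_compose_inv[OF b]) auto
    show "?m (map_permutation (f ` A) (inv_into A f) \<pi>) = \<pi>" if "\<pi> \<in> {\<pi>. \<pi> permutes f ` A}" for \<pi>
      using that by (intro map_permutation_compose_inv[OF bij_betw_inv_into[OF b]])
        (auto intro: f_inv_into_f)
  qed
  then have "minor M (f ` A) =
      (\<Sum>\<pi> | \<pi> permutes A. of_int (sign (?m \<pi>)) * (\<Prod>i\<in>f ` A. M i (?m \<pi> i)))"
    unfolding minor_def by (subst sum.reindex_bij_betw[symmetric]) auto
  also have "\<dots> = minor (\<lambda>i j. M (f i) (f j)) A"
    unfolding minor_def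
  proof (intro sum.cong arg_cong2[where f = "(*)"] refl)
    fix \<pi> assume "\<pi> \<in> {\<pi>. \<pi> permutes A}"
    then have \<pi>: "\<pi> permutes A" by simp
    show "of_int (sign (?m \<pi>)) = (of_int (sign \<pi>) :: 'c)"
      using sign_map_permutation[OF assms(2) \<pi> assms(1)] by simp
    have "M (f i) (?m \<pi> (f i)) = M (f i) (f (\<pi> i))" if "i \<in> A" for i
      using map_permutation_apply[OF assms(2) that] by simp
    then show "(\<Prod>i\<in>f ` A. M i (?m \<pi> i)) = (\<Prod>i\<in>A. M (f i) (f (\<pi> i)))"
      using assms by (simp add: prod.reindex)
  qed
  finally show ?thesis ..
qed

lemma det_mat: "det (mat m m (\<lambda>(i, j). M i j)) = minor M {..<m}"
  unfolding det_def minor_def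
  by (auto simp: lessThan_atLeast0 permutes_in_image intro!: sum.cong prod.cong arg_cong2[where f = "(*)"])

text \<open>A permutation of \<open>V\<close> moving a point outside \<open>S\<close> meets an
  off-diagonal zero of the padding. Padding brings minors on different sets to one index set, where
  determinants multiply.\<close>

lemma minor_pad:
  assumes "finite V" "S \<subseteq> V"
  shows "minor (\<lambda>i j. if i \<in> S \<and> j \<in> S then M i j else of_bool (i = j)) V = minor M S"
proof -
  let ?N = "\<lambda>i j. if i \<in> S \<and> j \<in> S then M i j else of_bool (i = j)"
  have fin: "finite {\<pi>. \<pi> permutes V}" using assms finite_permutations by blast
  have "minor M S = (\<Sum>\<pi> | \<pi> permutes S. of_int (sign \<pi>) * (\<Prod>i\<in>V. ?N i (\<pi> i)))"
    unfolding minor_def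
  proof (intro sum.cong arg_cong2[where f = "(*)"] refl)
    fix \<pi> assume "\<pi> \<in> {\<pi>. \<pi> permutes S}"
    then show "(\<Prod>i\<in>S. M i (\<pi> i)) = (\<Prod>i\<in>V. ?N i (\<pi> i))"
      using assms by (intro prod.mono_neutral_cong_left) (auto simp: permutes_in_image permutes_not_in)
  qed
  also have "\<dots> = minor ?N V"
    unfolding minor_def
  proof (intro sum.mono_neutral_left fin ballI)
    show "{\<pi>. \<pi> permutes S} \<subseteq> {\<pi>. \<pi> permutes V}" using assms permutes_subset by blast
    fix \<pi> assume "\<pi> \<in> {\<pi>. \<pi> permutes V} - {\<pi>. \<pi> permutes S}"
    then obtain i where "i \<in> V - S" "\<pi> i \<noteq> i"
      using permutes_superset[of \<pi> V S] by blast
    then have "(\<Prod>i\<in>V. ?N i (\<pi> i)) = 0"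
      using assms by (intro prod_zero) auto
    then show "of_int (sign \<pi>) * (\<Prod>i\<in>V. ?N i (\<pi> i)) = 0" by (simp only: mult_zero_right)
  qed
  finally show ?thesis ..
qed

lemma minor_mult:
  fixes M N :: "nat \<Rightarrow> nat \<Rightarrow> 'b::comm_ring_1"
  shows "minor M {..<n} * minor N {..<n} = minor (\<lambda>i j. \<Sum>k<n. M i k * N k j) {..<n}"
proof -
  let ?A = "mat n n (\<lambda>(i, j). M i j)" and ?B = "mat n n (\<lambda>(i, j). N i j)"
  have "?A * ?B = mat n n (\<lambda>(i, j). \<Sum>k<n. M i k * N k j)"
    by (rule eq_matI) (auto simp: scalar_prod_def lessThan_atLeast0)
  moreover have "det (?A * ?B) = det ?A * det ?B"
    by (rule det_mult[where n = n]) auto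
  ultimately show ?thesis by (simp add: det_mat)
qed

text \<open>Padded by the identity, the two blocks become \<open>n\<close> by \<open>n\<close>
  matrices whose product is the block-diagonal one.\<close>

lemma minor_block:
  fixes M N :: "nat \<Rightarrow> nat \<Rightarrow> 'b::comm_ring_1"
  assumes "S \<subseteq> {..<n}"
  shows "minor (\<lambda>i j. if i \<in> S \<and> j \<in> S then M i j else if i \<notin> S \<and> j \<notin> S then N i j else 0) {..<n} =
    minor M S * minor N ({..<n} - S)"
proof -
  let ?T = "{..<n} - S"
  let ?M = "\<lambda>i j. if i \<in> S \<and> j \<in> S then M i j else of_bool (i = j)"
  let ?N = "\<lambda>i j. if i \<in> ?T \<and> j \<in> ?T then N i j else of_bool (i = j)"
  have "minor M S * minor N ?T = minor ?M {..<n} * minor ?N {..<n}"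
    using assms by (simp only: minor_pad[OF finite_lessThan] Diff_subset)
  also have "\<dots> = minor (\<lambda>i j. \<Sum>k<n. ?M i k * ?N k j) {..<n}"
    by (rule minor_mult)
  also have "\<dots> = minor (\<lambda>i j. if i \<in> S \<and> j \<in> S then M i j
      else if i \<notin> S \<and> j \<notin> S then N i j else 0) {..<n}"
  proof (rule minor_cong)
    fix i j assume ij: "i \<in> {..<n}" "j \<in> {..<n}"
    have "?M i k * ?N k j = (if i \<in> S then (if k = j then if j \<in> S then M i j else 0 else 0)
        else (if k = i then ?N i j else 0))" if "k < n" for k
      using that ij by auto
    then have "(\<Sum>k<n. ?M i k * ?N k j) =
        (\<Sum>k<n. if i \<in> S then (if k = j then if j \<in> S then M i j else 0 else 0)
          else (if k = i then ?N i j else 0))"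
      by (intro sum.cong) auto
    then show "(\<Sum>k<n. ?M i k * ?N k j) = (if i \<in> S \<and> j \<in> S then M i j
        else if i \<notin> S \<and> j \<notin> S then N i j else 0)"
      using ij by (cases "i \<in> S") auto
  qed
  finally show ?thesis ..
qed

lemma minor_eq_0_kernel:
  fixes M :: "nat \<Rightarrow> nat \<Rightarrow> 'b::field"
  assumes "finite S" "minor M S = 0"
  shows "\<exists>v. (\<exists>i\<in>S. v i \<noteq> 0) \<and> (\<forall>i\<in>S. (\<Sum>j\<in>S. M i j * v j) = 0)"
proof -
  obtain f :: "nat \<Rightarrow> nat" where f: "bij_betw f {..<card S} S"
    using ex_bij_betw_nat_finite[OF assms(1)] by (auto simp: lessThan_atLeast0)
  let ?m = "card S"
  let ?A = "mat ?m ?m (\<lambda>(i, j). M (f i) (f j))"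
  have "det ?A = minor M (f ` {..<?m})"
    using f by (subst det_mat, subst minor_reindex) (auto simp: bij_betw_def)
  then have "det ?A = 0" using f assms(2) by (simp add: bij_betw_def)
  then obtain w where w: "w \<in> carrier_vec ?m" "w \<noteq> 0\<^sub>v ?m" "?A *\<^sub>v w = 0\<^sub>v ?m"
    using det_0_iff_vec_prod_zero[of ?A ?m] by auto
  define g where "g = inv_into {..<?m} f"
  have gf: "g (f i) = i" if "i < ?m" for i
    using f that by (simp add: g_def bij_betw_def)
  show ?thesis
  proof (intro exI[of _ "\<lambda>j. w $ g j"] conjI ballI)
    obtain i where "i < ?m" "w $ i \<noteq> 0" using w(1,2) by (auto simp: vec_eq_iff)
    then show "\<exists>i\<in>S. w $ g i \<noteq> 0" using f gf by (intro bexI[of _ "f i"]) (auto simp: bij_betw_def)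
    fix i assume "i \<in> S"
    then obtain k where k: "k < ?m" "i = f k" using f by (auto simp: bij_betw_def)
    have "(\<Sum>j\<in>S. M i j * w $ g j) = (\<Sum>j<?m. M (f k) (f j) * w $ j)"
      unfolding k using f gf by (subst sum.reindex_bij_betw[OF f, symmetric]) auto
    also have "\<dots> = (?A *\<^sub>v w) $ k"
      using k w(1) by (simp add: scalar_prod_def lessThan_atLeast0)
    finally show "(\<Sum>j\<in>S. M i j * w $ g j) = 0" using w(3) k by simp
  qed
qed

section \<open>Stability\<close>

text \<open>The matrix \<open>Z - a\<close> with \<open>Z\<close> diagonal. Each index has its own
  variable, so that stability can be proved by differentiating in one variable at a time.\<close>

definition pencil :: "('a \<Rightarrow> 'b) \<Rightarrow> ('a \<Rightarrow> 'a \<Rightarrow> 'b) \<Rightarrow> 'a \<Rightarrow> 'a \<Rightarrow> 'b::comm_ring_1" where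
  "pencil z a i j = (if i = j then z i else 0) - a i j"

text \<open>By \<open>minor_insert\<close> the determinant is affine in each variable; the slope is
  the minor without that index.\<close>

lemma minor_pencil_update:
  assumes "finite S" "k \<notin> S"
  shows "minor (pencil (z(k := w)) a) (insert k S) =
    w * minor (pencil z a) S + minor (pencil (z(k := 0)) a) (insert k S)"
proof -
  \<comment> \<open>Used at \<open>u = w\<close> and at \<open>u = 0\<close>, where the second
    summand is the same and cancels.\<close>
  have *: "minor (pencil (z(k := u)) a) (insert k S) = (u - a k k) * minor (pencil z a) S +
      minor ((pencil z a)(k := (pencil z a k)(k := 0))) (insert k S)" for u
  proof -
    have "minor (pencil (z(k := u)) a) S = minor (pencil z a) S"
      using assms by (intro minor_cong) (auto simp: pencil_def)
    moreover have "minor ((pencil (z(k := u)) a)(k := (pencil (z(k := u)) a k)(k := 0))) (insert k S) =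
        minor ((pencil z a)(k := (pencil z a k)(k := 0))) (insert k S)"
      by (intro minor_cong) (auto simp: pencil_def)
    ultimately show ?thesis
      using minor_insert[OF assms, of "pencil (z(k := u)) a"] by (simp add: pencil_def)
  qed
  show ?thesis unfolding *[of w] *[of 0] by (simp add: algebra_simps)
qed

text \<open>Conjugating a Hermitian form only swaps its two summation indices.\<close>

lemma quadratic_form_real:
  fixes a :: "'a \<Rightarrow> 'a \<Rightarrow> real" and v :: "'a \<Rightarrow> complex"
  assumes "\<And>i j. i \<in> S \<Longrightarrow> j \<in> S \<Longrightarrow> a i j = a j i"
  shows "Im (\<Sum>i\<in>S. \<Sum>j\<in>S. cnj (v i) * of_real (a i j) * v j) = 0"
proof -
  let ?q = "\<Sum>i\<in>S. \<Sum>j\<in>S. cnj (v i) * of_real (a i j) * v j"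
  have "cnj ?q = (\<Sum>i\<in>S. \<Sum>j\<in>S. cnj (v j) * of_real (a j i) * v i)"
    using assms by (auto simp: mult_ac intro!: sum.cong)
  also have "\<dots> = ?q" by (rule sum.swap)
  finally have "Im (cnj ?q) = Im ?q" by simp
  then show ?thesis by (simp only: cnj.simps neg_equal_zero)
qed

text \<open>A kernel vector \<open>v\<close> would satisfy \<open>Z v = a v\<close>. Pairing with
  \<open>v\<close> makes the sum of \<open>z i * |v i|^2\<close> real, although its imaginary part
  is positive.\<close>

lemma minor_pencil_nonzero:
  fixes a :: "nat \<Rightarrow> nat \<Rightarrow> real"
  assumes "finite S" "\<And>i j. i \<in> S \<Longrightarrow> j \<in> S \<Longrightarrow> a i j = a j i"
    and "\<And>i. i \<in> S \<Longrightarrow> Im (z i) > 0"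
  shows "minor (pencil z (\<lambda>i j. of_real (a i j))) S \<noteq> 0"
proof
  assume "minor (pencil z (\<lambda>i j. of_real (a i j))) S = 0"
  then obtain v where v: "\<exists>i\<in>S. v i \<noteq> 0"
    "\<And>i. i \<in> S \<Longrightarrow> (\<Sum>j\<in>S. pencil z (\<lambda>i j. of_real (a i j)) i j * v j) = 0"
    using minor_eq_0_kernel[OF assms(1)] by blast
  have eq: "z i * v i = (\<Sum>j\<in>S. of_real (a i j) * v j)" if "i \<in> S" for i
  proof -
    have "(\<Sum>j\<in>S. pencil z (\<lambda>i j. of_real (a i j)) i j * v j) =
        (\<Sum>j\<in>S. if i = j then z i * v i else 0) - (\<Sum>j\<in>S. of_real (a i j) * v j)"
      unfolding sum_subtractf[symmetric] by (intro sum.cong) (auto simp: pencil_def algebra_simps)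
    then show ?thesis using v(2)[OF that] that assms(1) by simp
  qed
  have "(\<Sum>i\<in>S. cnj (v i) * (z i * v i)) = (\<Sum>i\<in>S. \<Sum>j\<in>S. cnj (v i) * of_real (a i j) * v j)"
    by (intro sum.cong refl) (simp add: eq sum_distrib_left mult.assoc del: mult_cancel_left)
  then have "Im (\<Sum>i\<in>S. cnj (v i) * (z i * v i)) = 0"
    using quadratic_form_real[of S a v] assms(2) by simp
  moreover have "Im (\<Sum>i\<in>S. cnj (v i) * (z i * v i)) = (\<Sum>i\<in>S. Im (z i) * (cmod (v i))\<^sup>2)"
    unfolding Im_sum cmod_power2 by (intro sum.cong) (auto simp: algebra_simps power2_eq_square)
  moreover have "(\<Sum>i\<in>S. Im (z i) * (cmod (v i))\<^sup>2) > 0"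
  proof -
    obtain i where i: "i \<in> S" "v i \<noteq> 0" using v(1) by blast
    show ?thesis
      by (rule sum_pos2[OF assms(1) i(1)]) (use assms(3) i in \<open>auto intro!: mult_nonneg_nonneg simp: less_imp_le\<close>)
  qed
  ultimately show False by simp
qed

text \<open>The two roots are symmetric about the zero of the derivative, so one of them has imaginary
  part at least as large.\<close>

lemma quadratic_derivative_nonzero:
  fixes A B C w :: complex
  assumes "A \<noteq> 0" "\<And>w. Im w > 0 \<Longrightarrow> A * w\<^sup>2 + B * w + C \<noteq> 0" "Im w > 0"
  shows "2 * A * w + B \<noteq> 0"
proof
  assume "2 * A * w + B = 0"
  then have B: "B = - 2 * A * w" by (simp add: eq_neg_iff_add_eq_0 add.commute)
  define s where "s = csqrt (w\<^sup>2 - C / A)"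
  have s: "s\<^sup>2 = w\<^sup>2 - C / A" by (simp add: s_def)
  have root: "A * u\<^sup>2 + B * u + C = 0" if "u = w + s \<or> u = w - s" for u
  proof -
    have "A * u\<^sup>2 + B * u + C = A * (s\<^sup>2 - (w\<^sup>2 - C / A))"
      using that assms(1) unfolding B by (auto simp: field_simps power2_eq_square)
    then show ?thesis using s by simp
  qed
  have "Im (w + s) > 0 \<or> Im (w - s) > 0" using assms(3) by auto
  then show False using root assms(2) by blast
qed

text \<open>For disjoint \<open>U\<close> and \<open>W\<close>, this is the product of the
  determinants of \<open>Z - a\<close> and \<open>Z + a\<close> on \<open>U \<union> W\<close>,
  differentiated once in every variable of \<open>U\<close>. Indices in \<open>W\<close> occur in
  both factors, those in \<open>U\<close> in exactly one.\<close>

definition overlap_sum :: "('a \<Rightarrow> 'b) \<Rightarrow> ('a \<Rightarrow> 'a \<Rightarrow> 'b) \<Rightarrow> 'a set \<Rightarrow> 'a set \<Rightarrow> 'b::comm_ring_1" where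
  "overlap_sum z a U W = (\<Sum>S\<in>Pow U. minor (pencil z a) (S \<union> W) *
    minor (pencil z (\<lambda>i j. - a i j)) ((U - S) \<union> W))"

lemma sum_Pow_insert:
  assumes "finite U" "k \<notin> U"
  shows "(\<Sum>S\<in>Pow (insert k U). g S) = (\<Sum>S\<in>Pow U. g S + g (insert k S))"
proof -
  have "(\<Sum>S\<in>Pow (insert k U). g S) = (\<Sum>S\<in>Pow U. g S) + (\<Sum>S\<in>insert k ` Pow U. g S)"
    unfolding Pow_insert using assms by (intro sum.union_disjoint) auto
  also have "(\<Sum>S\<in>insert k ` Pow U. g S) = (\<Sum>S\<in>Pow U. g (insert k S))"
    using assms by (subst sum.reindex) (auto intro!: inj_onI simp: insert_ident)
  finally show ?thesis by (simp add: sum.distrib)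
qed

text \<open>Moving \<open>k\<close> from \<open>W\<close> to \<open>U\<close> differentiates the sum, a quadratic polynomial in \<open>z k\<close>.\<close>

lemma overlap_sum_nonzero:
  fixes a :: "nat \<Rightarrow> nat \<Rightarrow> real"
  assumes "finite U" "finite W" "U \<inter> W = {}"
    and sym: "\<And>i j. i \<in> U \<union> W \<Longrightarrow> j \<in> U \<union> W \<Longrightarrow> a i j = a j i"
    and "\<And>i. i \<in> U \<union> W \<Longrightarrow> Im (z i) > 0"
  shows "overlap_sum z (\<lambda>i j. of_real (a i j)) U W \<noteq> 0"
  using assms
proof (induction U arbitrary: W z rule: finite_induct)
  case empty
  then show ?case
    using minor_pencil_nonzero[of W a z] minor_pencil_nonzero[of W "\<lambda>i j. - a i j" z]
    by (simp add: overlap_sum_def)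
next
  case (insert k U)
  let ?a = "\<lambda>i j. complex_of_real (a i j)"
  let ?p = "\<lambda>z. minor (pencil z ?a)" and ?m = "\<lambda>z. minor (pencil z (\<lambda>i j. - ?a i j))"
  \<comment> \<open>As functions of the variable of \<open>k\<close>, the two minors with
    \<open>k\<close> adjoined have slopes \<open>\<alpha> S\<close>, \<open>\<beta> S\<close> and
    constant terms \<open>\<alpha>' S\<close>, \<open>\<beta>' S\<close>.\<close>
  define \<alpha> where "\<alpha> S = ?p z (S \<union> W)" for S
  define \<alpha>' where "\<alpha>' S = ?p (z(k := 0)) (insert k (S \<union> W))" for S
  define \<beta> where "\<beta> S = ?m z ((U - S) \<union> W)" for S
  define \<beta>' where "\<beta>' S = ?m (z(k := 0)) (insert k ((U - S) \<union> W))" for S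
  \<comment> \<open>The quadratic with these coefficients is the sum for \<open>U\<close> and
    \<open>insert k W\<close>, its leading coefficient \<open>A\<close> is the sum for
    \<open>U\<close> and \<open>W\<close>, and its derivative is the sum for
    \<open>insert k U\<close> and \<open>W\<close>. The induction hypothesis covers the first
    two.\<close>
  define A B C where "A = (\<Sum>S\<in>Pow U. \<alpha> S * \<beta> S)"
    and "B = (\<Sum>S\<in>Pow U. \<alpha> S * \<beta>' S + \<alpha>' S * \<beta> S)" and "C = (\<Sum>S\<in>Pow U. \<alpha>' S * \<beta>' S)"
  have fresh: "k \<notin> W" "k \<notin> U" using insert.prems insert.hyps by auto
  have p: "?p (z(k := w)) (insert k (S \<union> W)) = w * \<alpha> S + \<alpha>' S" if "S \<subseteq> U" for S w
    unfolding \<alpha>_def \<alpha>'_def using that fresh insert.hyps insert.prems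
    by (intro minor_pencil_update) (auto intro: finite_subset)
  have m: "?m (z(k := w)) (insert k ((U - S) \<union> W)) = w * \<beta> S + \<beta>' S" if "S \<subseteq> U" for S w
    unfolding \<beta>_def \<beta>'_def using that fresh insert.hyps insert.prems
    by (intro minor_pencil_update) (auto intro: finite_subset)
  have "A \<noteq> 0"
    using insert.IH[of W z] insert.prems by (auto simp: A_def \<alpha>_def \<beta>_def overlap_sum_def)
  moreover have "A * w\<^sup>2 + B * w + C \<noteq> 0" if "Im w > 0" for w
  proof -
    have "overlap_sum (z(k := w)) ?a U (insert k W) =
        (\<Sum>S\<in>Pow U. (w * \<alpha> S + \<alpha>' S) * (w * \<beta> S + \<beta>' S))"
      unfolding overlap_sum_def by (intro sum.cong refl) (simp add: p m)
    also have "\<dots> = A * w\<^sup>2 + B * w + C"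
      unfolding A_def B_def C_def sum_distrib_right sum.distrib[symmetric]
      by (intro sum.cong) (auto simp: algebra_simps power2_eq_square)
    finally have "overlap_sum (z(k := w)) ?a U (insert k W) = A * w\<^sup>2 + B * w + C" .
    moreover have "overlap_sum (z(k := w)) ?a U (insert k W) \<noteq> 0"
      by (rule insert.IH) (use insert.prems insert.hyps that in auto)
    ultimately show ?thesis by simp
  qed
  moreover have "Im (z k) > 0" using insert.prems by simp
  ultimately have "2 * A * z k + B \<noteq> 0" by (rule quadratic_derivative_nonzero)
  moreover have "overlap_sum z ?a (insert k U) W = 2 * A * z k + B"
  proof -
    have sets: "insert k U - S = insert k (U - S)" "insert k U - insert k S = U - S"
      if "S \<subseteq> U" for S using that fresh by auto
    have "overlap_sum z ?a (insert k U) W =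
        (\<Sum>S\<in>Pow U. \<alpha> S * (z k * \<beta> S + \<beta>' S) + (z k * \<alpha> S + \<alpha>' S) * \<beta> S)"
      unfolding overlap_sum_def sum_Pow_insert[OF insert.hyps]
    proof (intro sum.cong refl)
      fix S assume "S \<in> Pow U"
      then show "?p z (S \<union> W) * ?m z ((insert k U - S) \<union> W) +
          ?p z (insert k S \<union> W) * ?m z ((insert k U - insert k S) \<union> W) =
          \<alpha> S * (z k * \<beta> S + \<beta>' S) + (z k * \<alpha> S + \<alpha>' S) * \<beta> S"
        using p[of S "z k"] m[of S "z k"] unfolding \<alpha>_def \<beta>_def Pow_iff
        by (simp only: sets fun_upd_triv Un_insert_left)
    qed
    also have "\<dots> = 2 * A * z k + B"
      unfolding A_def B_def sum_distrib_right sum_distrib_left sum.distrib[symmetric]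
      by (intro sum.cong) (auto simp: algebra_simps)
    finally show ?thesis .
  qed
  ultimately show ?case by simp
qed

section \<open>Signed cuts and Schur complements\<close>

definition signed_cut :: "('a \<Rightarrow> 'a \<Rightarrow> 'b) \<Rightarrow> 'a set \<Rightarrow> 'a \<Rightarrow> 'a \<Rightarrow> 'b::comm_ring_1" where
  "signed_cut a S i j = (if i \<in> S \<and> j \<in> S then a i j else if i \<notin> S \<and> j \<notin> S then - a i j else 0)"

lemma minor_pencil_cut:
  fixes n :: nat
  assumes "S \<subseteq> {..<n}"
  shows "minor (pencil z (signed_cut a S)) {..<n} =
    minor (pencil z a) S * minor (pencil z (\<lambda>i j. - a i j)) ({..<n} - S)"
proof -
  have "minor (pencil z (signed_cut a S)) {..<n} = minor (\<lambda>i j. if i \<in> S \<and> j \<in> S then pencil z a i j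
      else if i \<notin> S \<and> j \<notin> S then pencil z (\<lambda>i j. - a i j) i j else 0) {..<n}"
    by (intro minor_cong) (auto simp: pencil_def signed_cut_def)
  then show ?thesis using minor_block[OF assms] by simp
qed

text \<open>The case \<open>W = {}\<close> of \<open>overlap_sum_nonzero\<close>, each product of
  minors being one minor of a block-diagonal matrix.\<close>

lemma sum_minor_cut_nonzero:
  fixes a :: "nat \<Rightarrow> nat \<Rightarrow> real"
  assumes "\<And>i j. i < n \<Longrightarrow> j < n \<Longrightarrow> a i j = a j i" "\<And>i. i < n \<Longrightarrow> Im (z i) > 0"
  shows "(\<Sum>S\<in>Pow {..<n}. minor (pencil z (signed_cut (\<lambda>i j. of_real (a i j)) S)) {..<n}) \<noteq> 0"
  using overlap_sum_nonzero[of "{..<n}" "{}" a z] assms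
  by (simp add: overlap_sum_def minor_pencil_cut cong: sum.cong_simp)

text \<open>Subtracting from the last column the combination of the others given by \<open>y\<close>
  clears it except for the corner. A solution \<open>y\<close> replaces the inverse, so the identity
  makes sense over any commutative ring.\<close>

lemma minor_schur:
  fixes M :: "nat \<Rightarrow> nat \<Rightarrow> 'b::comm_ring_1"
  assumes "\<And>i. i < n \<Longrightarrow> (\<Sum>j<n. M i j * y j) = M i n"
  shows "minor M {..<Suc n} = minor M {..<n} * (M n n - (\<Sum>j<n. M n j * y j))"
proof -
  \<comment> \<open>The column operation as a unit upper triangular factor: the identity with
    \<open>- y\<close> above the corner.\<close>
  define U where "U i j = (if j = n \<and> i < n then - y i else of_bool (i = j))" for i j
  let ?N = "\<lambda>i j. \<Sum>k<Suc n. M i k * U k j"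
  have N_left: "?N i j = M i j" if "j < n" for i j
  proof -
    have "?N i j = (\<Sum>k<Suc n. if k = j then M i j else 0)"
      using that by (intro sum.cong) (auto simp: U_def)
    then show ?thesis using that by simp
  qed
  have N_right: "?N i n = M i n - (\<Sum>j<n. M i j * y j)" for i
    by (simp add: U_def sum_negf)
  have "minor U {..<Suc n} = 1"
  proof -
    have "det (mat (Suc n) (Suc n) (\<lambda>(i, j). U i j)) =
        prod_list (diag_mat (mat (Suc n) (Suc n) (\<lambda>(i, j). U i j)))"
      by (rule det_upper_triangular[of _ "Suc n"]) (auto simp: upper_triangular_def U_def)
    also have "\<dots> = 1"
      by (simp add: prod_list_diag_prod U_def)
    finally show ?thesis by (simp add: det_mat)
  qed
  then have "minor M {..<Suc n} = minor ?N {..<Suc n}"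
    using minor_mult[of M "Suc n" U] by simp
  also have "\<dots> = ?N n n * minor ?N {..<n} +
      minor (?N(n := (?N n)(n := 0))) {..<Suc n}"
    using minor_insert[of "{..<n}" n ?N] by (simp add: lessThan_Suc)
  also have "minor ?N {..<n} = minor M {..<n}"
    using N_left by (intro minor_cong) simp
  also have "minor (?N(n := (?N n)(n := 0))) {..<Suc n} = 0"
  proof -
    let ?K = "?N(n := (?N n)(n := 0))"
    \<comment> \<open>With the corner erased the whole column \<open>n\<close> vanishes, and every
      permutation selects one entry of it.\<close>
    have zero: "?K i n = 0" if "i < Suc n" for i
      using assms N_right that by (cases "i = n") auto
    have "(\<Prod>i<Suc n. ?K i (\<pi> i)) = 0" if "\<pi> permutes {..<Suc n}" for \<pi>
    proof (rule prod_zero)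
      have "n \<in> \<pi> ` {..<Suc n}" using permutes_image[OF that] by simp
      then obtain i where i: "i < Suc n" "\<pi> i = n" by blast
      then have "?K i (\<pi> i) = 0" using zero[OF i(1)] by (simp only:)
      then show "\<exists>i\<in>{..<Suc n}. ?K i (\<pi> i) = 0" using i(1) by (intro bexI[of _ i]) (simp_all only: lessThan_iff)
    qed simp
    then show ?thesis by (simp add: minor_def)
  qed
  finally have "minor M {..<Suc n} = (M n n - (\<Sum>j<n. M n j * y j)) * minor M {..<n}"
    by (simp only: N_right add_0_right)
  then show ?thesis by (simp only: mult.commute)
qed

section \<open>Rational functions preserving half-planes\<close>

interpretation of_real_poly_hom: map_poly_inj_idom_hom "of_real :: real \<Rightarrow> complex" ..

abbreviation cpoly :: "real poly \<Rightarrow> complex poly" where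
  "cpoly \<equiv> map_poly of_real"

lemma cpoly_cnj: "poly (cpoly p) (cnj z) = cnj (poly (cpoly p) z)"
  using poly_cnj_real[of "cpoly p" z] by (simp add: coeff_map_poly)

text \<open>Zeros of a real polynomial come in conjugate pairs, so none can lie in the lower
  half-plane either.\<close>

lemma cpoly_real_root:
  assumes "\<And>z. Im z > 0 \<Longrightarrow> poly (cpoly p) z \<noteq> 0" "poly (cpoly p) z = 0"
  shows "Im z = 0"
proof (rule ccontr)
  assume "Im z \<noteq> 0"
  then consider "Im z > 0" | "Im (cnj z) > 0" by force
  then show False
    by cases (use assms cpoly_cnj[of p z] in auto)
qed

lemma tendsto_ray: "((\<lambda>t. of_real a + of_real t * u) \<longlongrightarrow> (of_real a :: complex)) (at_right 0)"
proof -
  have "((\<lambda>t. of_real a + of_real t * u) \<longlongrightarrow> (of_real a + of_real 0 * u :: complex)) (at_right 0)"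
    by (intro tendsto_intros)
  then show ?thesis by simp
qed

text \<open>Near a root of order \<open>k\<close> the quotient behaves like \<open>c / w^k\<close>.
  Approaching along a ray of direction \<open>u\<close> in the upper half-plane forces
  \<open>c * Im (u ^ k) \<ge> 0\<close>. For \<open>k \<ge> 2\<close> the powers
  \<open>u ^ k\<close> reach both signs of the imaginary part, so \<open>k = 1\<close>, and then
  \<open>c\<close> is the residue.\<close>

lemma pick_pole:
  fixes p q :: "real poly"
  assumes p0: "p \<noteq> 0"
    and up: "\<And>z. Im z > 0 \<Longrightarrow> poly (cpoly p) z \<noteq> 0 \<and> Im (poly (cpoly q) z / poly (cpoly p) z) \<le> 0"
    and root: "poly p a = 0" and q: "poly q a \<noteq> 0"
  shows "poly (pderiv p) a \<noteq> 0 \<and> poly q a / poly (pderiv p) a \<ge> 0"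
proof -
  define k where "k = order a p"
  obtain p1 where p1: "p = [:- a, 1:] ^ k * p1" "\<not> [:- a, 1:] dvd p1"
    using order_decomp[OF p0] unfolding k_def by blast
  have p1a: "poly p1 a \<noteq> 0" using p1(2) by (simp add: poly_eq_0_iff_dvd)
  have k: "k > 0" using root p0 by (simp add: k_def order_root)
  define c where "c = poly q a / poly p1 a"
  have c0: "c \<noteq> 0" using q p1a by (simp add: c_def)
  have factor: "poly (cpoly p) (of_real a + w) = w ^ k * poly (cpoly p1) (of_real a + w)" for w :: complex
    unfolding p1(1) by (simp add: of_real_poly_hom.hom_mult of_real_poly_hom.hom_power)
  have angle: "c * Im (u ^ k) \<ge> 0" if u: "Im u > 0" for u
  proof -
    let ?g = "\<lambda>z. poly (cpoly q) z / poly (cpoly p1) z"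
    have "(?g \<longlongrightarrow> ?g (of_real a)) (at (of_real a))"
      using p1a by (intro tendsto_intros tendsto_poly tendsto_ident_at) simp
    then have "isCont ?g (of_real a)" by (simp add: isCont_def)
    then have "((\<lambda>t. ?g (of_real a + of_real t * u) / u ^ k) \<longlongrightarrow> ?g (of_real a) / u ^ k) (at_right 0)"
      using u by (intro tendsto_divide tendsto_const isCont_tendsto_compose[OF _ tendsto_ray]) auto
    then have lim: "((\<lambda>t. Im (?g (of_real a + of_real t * u) / u ^ k)) \<longlongrightarrow> Im (?g (of_real a) / u ^ k)) (at_right 0)"
      by (rule tendsto_Im)
    have "eventually (\<lambda>t::real. Im (?g (of_real a + of_real t * u) / u ^ k) \<le> 0) (at_right 0)"
    proof (rule eventually_mono[OF eventually_at_right_less])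
      fix t :: real assume t: "0 < t"
      let ?z = "of_real a + of_real t * u"
      have "Im ?z > 0" using t u by simp
      then have "Im (poly (cpoly q) ?z / poly (cpoly p) ?z) \<le> 0" using up by blast
      \<comment> \<open>The blow-up is confined to the positive real factor
        \<open>1 / t ^ k\<close>, which does not affect the sign and is dropped before the
        limit.\<close>
      moreover have "poly (cpoly q) ?z / poly (cpoly p) ?z = of_real (1 / t ^ k) * (?g ?z / u ^ k)"
        by (simp add: factor power_mult_distrib)
      moreover have "Im (of_real s * w) = s * Im w" for s w by simp
      ultimately have "1 / t ^ k * Im (?g ?z / u ^ k) \<le> 0" by (simp only:)
      moreover have "t ^ k > 0" using t by simp
      ultimately show "Im (?g ?z / u ^ k) \<le> 0" by (simp add: pos_divide_le_eq)
    qed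
    then have "Im (?g (of_real a) / u ^ k) \<le> 0"
      by (rule tendsto_upperbound[OF lim]) simp
    moreover have "?g (of_real a) = of_real c" by (simp add: c_def)
    moreover have "Im (of_real c * w) = c * Im w" for w by simp
    ultimately have le: "c * Im (inverse (u ^ k)) \<le> 0"
      by (simp only: divide_inverse[of "of_real c"])
    have "u ^ k \<noteq> 0" using u by auto
    then have "(Re (u ^ k))\<^sup>2 + (Im (u ^ k))\<^sup>2 > 0"
      unfolding cmod_power2[symmetric] by simp
    moreover have "c * Im (inverse (u ^ k)) = - (c * Im (u ^ k)) / ((Re (u ^ k))\<^sup>2 + (Im (u ^ k))\<^sup>2)"
      by (simp only: inverse_complex.sel) simp
    ultimately show ?thesis using le by (simp only: pos_divide_le_eq)
  qed
  have "k = 1"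
  proof (rule ccontr)
    assume "k \<noteq> 1"
    with k have k2: "k \<ge> 2" by simp
    have sin: "Im (cis \<theta>) > 0" if "0 < \<theta>" "\<theta> < pi" for \<theta>
      using that sin_gt_zero by simp
    \<comment> \<open>Unit directions with these two arguments have \<open>k\<close>-th powers
      \<open>\<i>\<close> and \<open>- \<i>\<close>; \<open>k \<ge> 2\<close> keeps the second one
      in the upper half-plane.\<close>
    have lt: "pi / (2 * real k) < pi" "3 * pi / (2 * real k) < pi"
      using k2 pi_gt_zero by (simp_all add: divide_less_eq)
    have h1: "c * sin (real k * (pi / (2 * k))) \<ge> 0"
      using angle[OF sin[OF _ lt(1)]] k2 by (simp add: DeMoivre)
    have h2: "c * sin (real k * (3 * pi / (2 * k))) \<ge> 0"
      using angle[OF sin[OF _ lt(2)]] k2 by (simp add: DeMoivre)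
    have eq: "real k * (pi / (2 * k)) = pi / 2" "real k * (3 * pi / (2 * k)) = 3 / 2 * pi"
      using k2 by (simp_all add: field_simps)
    show False using h1[unfolded eq sin_pi_half] h2[unfolded eq sin_3over2_pi] c0 by simp
  qed
  then have "poly (pderiv p) a = poly p1 a"
    unfolding p1(1) by (simp add: pderiv_mult pderiv_pCons del: mult_pCons_left)
  moreover have "c \<ge> 0" using angle[of \<i>] \<open>k = 1\<close> by simp
  ultimately show ?thesis using p1a by (simp add: c_def)
qed

text \<open>Common real roots are divided out by induction on the degree. Once there are none, the
  roots of \<open>p\<close> are real, simple and of nonnegative residue by \<open>pick_pole\<close>,
  and Lagrange interpolation at them recovers \<open>q\<close>.\<close>

lemma pick_partial_fractions:
  fixes p q :: "real poly"
  assumes "p \<noteq> 0" "q = 0 \<or> degree q < degree p"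
    and "\<And>z. Im z > 0 \<Longrightarrow> poly (cpoly p) z \<noteq> 0 \<and> Im (poly (cpoly q) z / poly (cpoly p) z) \<le> 0"
  shows "\<exists>R c. finite R \<and> (\<forall>a\<in>R. poly p a = 0 \<and> 0 \<le> c a) \<and>
    (\<forall>x. poly p x \<noteq> 0 \<longrightarrow> poly q x / poly p x = (\<Sum>a\<in>R. c a / (x - a)))"
  using assms
proof (induction "degree p" arbitrary: p q rule: less_induct)
  case less
  note up = less.prems(3)
  show ?case
  proof (cases "q = 0 \<or> (\<exists>a. poly p a = 0 \<and> poly q a = 0)")
    case True1: True
    show ?thesis
    proof (cases "q = 0")
      case True
      then show ?thesis by (intro exI[of _ "{}"]) auto
    next
      case False
      then obtain a where "poly p a = 0" "poly q a = 0" using False True1 by blast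
      then obtain p1 q1 where pq: "p = [:- a, 1:] * p1" "q = [:- a, 1:] * q1"
        by (meson poly_eq_0_iff_dvd dvdE)
      have nz: "p1 \<noteq> 0" "q1 \<noteq> 0" using less.prems(1) False pq by auto
      have deg: "degree p = Suc (degree p1)" "degree q = Suc (degree q1)"
        using nz unfolding pq by (subst degree_mult_eq; simp)+
      have fac: "poly (cpoly p) z = (z - of_real a) * poly (cpoly p1) z"
        "poly (cpoly q) z = (z - of_real a) * poly (cpoly q1) z" for z
        unfolding pq of_real_poly_hom.hom_mult poly_mult by simp_all
      have "\<exists>R c. finite R \<and> (\<forall>b\<in>R. poly p1 b = 0 \<and> 0 \<le> c b) \<and>
        (\<forall>x. poly p1 x \<noteq> 0 \<longrightarrow> poly q1 x / poly p1 x = (\<Sum>b\<in>R. c b / (x - b)))"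
      proof (rule less.hyps)
        show "degree p1 < degree p" "p1 \<noteq> 0" "q1 = 0 \<or> degree q1 < degree p1"
          using deg nz less.prems(2) False by auto
        fix z :: complex assume z: "Im z > 0"
        then have "z \<noteq> of_real a" by auto
        then show "poly (cpoly p1) z \<noteq> 0 \<and> Im (poly (cpoly q1) z / poly (cpoly p1) z) \<le> 0"
          using up[OF z] by (simp add: fac)
      qed
      then obtain R c where R: "finite R" "\<forall>b\<in>R. poly p1 b = 0 \<and> 0 \<le> c b"
        "\<forall>x. poly p1 x \<noteq> 0 \<longrightarrow> poly q1 x / poly p1 x = (\<Sum>b\<in>R. c b / (x - b))" by blast
      have fac': "poly p x = (x - a) * poly p1 x" "poly q x = (x - a) * poly q1 x" for x
        unfolding pq poly_mult by simp_all
      show ?thesis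
        by (intro exI[of _ R] exI[of _ c] conjI) (use R in \<open>auto simp: fac'\<close>)
    qed
  next
    case False
    define R where "R = {a. poly p a = 0}"
    define c where "c a = poly q a / poly (pderiv p) a" for a
    have fin: "finite R" using less.prems(1) poly_roots_finite by (simp add: R_def)
    have simple: "poly (pderiv p) a \<noteq> 0" "c a \<ge> 0" if "a \<in> R" for a
      using pick_pole[OF less.prems(1) up, of a] that False by (auto simp: R_def c_def)
    have real_root: "Im z = 0" if "poly (cpoly p) z = 0" for z
      using cpoly_real_root[of p z] up that by blast
    have roots: "{z. poly (cpoly p) z = 0} = of_real ` R"
    proof (intro equalityI subsetI)
      fix z assume "z \<in> {z. poly (cpoly p) z = 0}"
      then have "z = of_real (Re z)" "poly (cpoly p) z = 0" using real_root by (auto simp: complex_eq_iff)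
      then have "poly (cpoly p) (of_real (Re z)) = 0" by metis
      then have "Re z \<in> R" by (simp add: R_def)
      then show "z \<in> of_real ` R" using \<open>z = of_real (Re z)\<close> by blast
    qed (auto simp: R_def)
    \<comment> \<open>Simplicity of all complex roots makes the number of real roots equal to the
      degree, as interpolation needs.\<close>
    have "rsquarefree (cpoly p)"
      unfolding rsquarefree_roots
    proof (intro allI notI)
      fix z assume z: "poly (cpoly p) z = 0 \<and> poly (pderiv (cpoly p)) z = 0"
      then obtain a where a: "a \<in> R" "z = of_real a" using roots by blast
      then show False using z simple(1)[OF a(1)]
        by (simp add: of_real_hom.map_poly_pderiv[symmetric])
    qed
    then have "card (of_real ` R :: complex set) = degree (cpoly p)"
      using rsquarefree_card_degree[of "cpoly p"] less.prems(1) roots by simp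
    then have card: "card R = degree p"
      by (simp add: card_image inj_on_def)
    \<comment> \<open>The unnormalised Lagrange basis: \<open>r a\<close> vanishes at the other
      roots and equals the derivative of \<open>p\<close> at \<open>a\<close>.\<close>
    define r where "r a = p div [:- a, 1:]" for a
    have r: "p = [:- a, 1:] * r a" if "a \<in> R" for a
      using that by (metis R_def r_def dvd_mult_div_cancel mem_Collect_eq poly_eq_0_iff_dvd)
    have r_deg: "degree (r a) < degree p" if "a \<in> R" for a
    proof -
      have "r a \<noteq> 0" using r[OF that] less.prems(1) by auto
      then have "degree ([:- a, 1:] * r a) = Suc (degree (r a))" by (subst degree_mult_eq) auto
      then show ?thesis using r[OF that] by simp
    qed
    have r_self: "poly (r a) a = poly (pderiv p) a" if "a \<in> R" for a
      by (subst r[OF that]) (simp add: pderiv_mult pderiv_pCons del: mult_pCons_left)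
    have r_other: "poly (r a) b = 0" if "a \<in> R" "b \<in> R" "a \<noteq> b" for a b
    proof -
      have "poly ([:- a, 1:] * r a) b = 0" using r[OF that(1)] that(2) by (simp add: R_def)
      then show ?thesis using that(3) by simp
    qed
    have pos: "degree p > 0" using less.prems(2) False by auto
    \<comment> \<open>Both sides have degree below \<open>card R\<close> and agree on
      \<open>R\<close>.\<close>
    have "q = (\<Sum>a\<in>R. smult (c a) (r a))"
    proof (rule poly_eqI_degree[of R])
      fix b assume b: "b \<in> R"
      have "poly (\<Sum>a\<in>R. smult (c a) (r a)) b = (\<Sum>a\<in>R. if a = b then c b * poly (r b) b else 0)"
        unfolding poly_sum by (intro sum.cong) (use b r_other in auto)
      also have "\<dots> = poly q b" using fin b simple(1) by (simp add: r_self c_def)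
      finally show "poly q b = poly (\<Sum>a\<in>R. smult (c a) (r a)) b" ..
    next
      show "card R > degree q" using card less.prems(2) False by auto
      show "card R > degree (\<Sum>a\<in>R. smult (c a) (r a))"
        unfolding card using pos r_deg
        by (intro degree_sum_less) (auto intro: le_less_trans[OF degree_smult_le])
    qed
    moreover have "poly (\<Sum>a\<in>R. smult (c a) (r a)) x / poly p x = (\<Sum>a\<in>R. c a / (x - a))"
      if "poly p x \<noteq> 0" for x
      unfolding poly_sum sum_divide_distrib
    proof (intro sum.cong refl)
      fix a assume a: "a \<in> R"
      have px: "poly p x = (x - a) * poly (r a) x" by (subst r[OF a]) (simp add: algebra_simps)
      then show "poly (smult (c a) (r a)) x / poly p x = c a / (x - a)" using that by simp
    qed
    ultimately show ?thesis
      using fin simple(2) by (intro exI[of _ R] exI[of _ c]) (auto simp: R_def)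
  qed
qed

text \<open>Oddness pairs the pole terms at \<open>x\<close> and \<open>- x\<close>:
  \<open>c / (x - a) + c / (x + a)\<close> is \<open>2 * c * x / (x^2 - a^2)\<close>, which only
  grows when \<open>a^2\<close> is replaced by \<open>r^2\<close>. The resulting bound expands as
  \<open>m / x + m * r^2 / x^3 + ...\<close>, so it controls the second moment.\<close>

lemma pick_odd_bound:
  fixes p q :: "real poly"
  assumes p0: "p \<noteq> 0" and deg: "degree q < degree p"
    and up: "\<And>z. Im z > 0 \<Longrightarrow> poly (cpoly p) z \<noteq> 0 \<and> Im (poly (cpoly q) z / poly (cpoly p) z) \<le> 0"
    and odd: "\<And>x. poly q (- x) / poly p (- x) = - (poly q x / poly p x)"
    and roots: "\<And>x. poly p x = 0 \<Longrightarrow> x\<^sup>2 \<le> r\<^sup>2"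
    and m: "((\<lambda>x. x * (poly q x / poly p x)) \<longlongrightarrow> m) at_top"
    and x: "x > \<bar>r\<bar>"
  shows "poly q x / poly p x \<le> m * x / (x\<^sup>2 - r\<^sup>2)"
proof -
  obtain R c where fin: "finite R" and R: "\<And>a. a \<in> R \<Longrightarrow> poly p a = 0" "\<And>a. a \<in> R \<Longrightarrow> 0 \<le> c a"
    and pf: "\<And>x. poly p x \<noteq> 0 \<Longrightarrow> poly q x / poly p x = (\<Sum>a\<in>R. c a / (x - a))"
    using pick_partial_fractions[of p q] p0 deg up by blast
  have big: "a\<^sup>2 \<le> r\<^sup>2" if "a \<in> R" for a using roots R(1) that by blast
  have lt: "r\<^sup>2 < y\<^sup>2" if "\<bar>y\<bar> > \<bar>r\<bar>" for y using that by (metis abs_ge_zero power2_abs power_strict_mono zero_less_numeral)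
  have nz: "poly p y \<noteq> 0" if "\<bar>y\<bar> > \<bar>r\<bar>" for y
    using lt[OF that] roots[of y] by fastforce
  \<comment> \<open>Times \<open>x\<close>, each pole term tends to its residue, so \<open>m\<close>
    is the sum of the residues.\<close>
  have "((\<lambda>x. \<Sum>a\<in>R. c a * (x / (x - a))) \<longlongrightarrow> (\<Sum>a\<in>R. c a * 1)) at_top"
  proof (intro tendsto_sum tendsto_mult tendsto_const)
    fix a :: real
    show "((\<lambda>x. x / (x - a)) \<longlongrightarrow> 1) at_top"
      by real_asymp
  qed
  moreover have "eventually (\<lambda>x. x * (poly q x / poly p x) = (\<Sum>a\<in>R. c a * (x / (x - a)))) at_top"
    using eventually_gt_at_top[of "\<bar>r\<bar>"]
  proof eventually_elim
    case (elim x)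
    then show ?case using nz[of x] by (simp add: pf sum_distrib_left mult_ac)
  qed
  ultimately have "((\<lambda>x. x * (poly q x / poly p x)) \<longlongrightarrow> (\<Sum>a\<in>R. c a)) at_top"
    by (simp add: tendsto_cong)
  then have m_eq: "m = (\<Sum>a\<in>R. c a)"
    using m tendsto_unique[OF trivial_limit_at_top_linorder] by blast
  have x': "\<bar>x\<bar> > \<bar>r\<bar>" "\<bar>- x\<bar> > \<bar>r\<bar>" using x by auto
  let ?f = "\<lambda>x. poly q x / poly p x"
  have "2 * ?f x = ?f x - ?f (- x)" using odd[of x] by simp
  also have "\<dots> = (\<Sum>a\<in>R. c a / (x - a) - c a / (- x - a))"
    by (simp only: pf[OF nz[OF x'(1)]] pf[OF nz[OF x'(2)]] sum_subtractf)
  also have "\<dots> \<le> (\<Sum>a\<in>R. c a * (2 * x / (x\<^sup>2 - r\<^sup>2)))"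
  proof (rule sum_mono)
    fix a assume a: "a \<in> R"
    have pos: "x\<^sup>2 - r\<^sup>2 > 0" "x\<^sup>2 - r\<^sup>2 \<le> x\<^sup>2 - a\<^sup>2" using lt[OF x'(1)] big[OF a] by auto
    have "x\<^sup>2 - a\<^sup>2 = (x - a) * (x + a)" by (simp add: power2_eq_square algebra_simps)
    then have nz': "x - a \<noteq> 0" "x + a \<noteq> 0" using pos by auto
    have "c a / (x - a) - c a / (- x - a) = c a * (2 * x / (x\<^sup>2 - a\<^sup>2))"
    proof -
      have "c a / (x - a) + c a / (x + a) = (c a * (x + a) + c a * (x - a)) / ((x - a) * (x + a))"
        using nz' by (rule add_frac_eq)
      also have "c a * (x + a) + c a * (x - a) = c a * (2 * x)" by (simp add: algebra_simps)
      finally have "c a / (x - a) + c a / (x + a) = c a * (2 * x / (x\<^sup>2 - a\<^sup>2))"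
        unfolding \<open>x\<^sup>2 - a\<^sup>2 = _\<close> by simp
      moreover have "c a / (- x - a) = - (c a / (x + a))"
        by (metis minus_add_distrib minus_divide_right uminus_add_conv_diff add.commute)
      ultimately show ?thesis by simp
    qed
    also have "\<dots> \<le> c a * (2 * x / (x\<^sup>2 - r\<^sup>2))"
      using pos x by (intro mult_left_mono R(2)[OF a] divide_left_mono mult_pos_pos) auto
    finally show "c a / (x - a) - c a / (- x - a) \<le> c a * (2 * x / (x\<^sup>2 - r\<^sup>2))" .
  qed
  also have "\<dots> = 2 * (m * x / (x\<^sup>2 - r\<^sup>2))"
    by (simp add: m_eq sum_distrib_left sum_distrib_right sum_divide_distrib mult_ac)
  finally show ?thesis by simp
qed

section \<open>Bordered matrices\<close>

text \<open>Generic in the ring, so that the same sum serves real and complex numbers and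
  polynomials; \<open>hom_cut_sum\<close> and \<open>poly_cut_sum\<close> pass between them.\<close>

definition cut_sum :: "nat \<Rightarrow> (nat \<Rightarrow> 'b) \<Rightarrow> (nat \<Rightarrow> nat \<Rightarrow> 'b) \<Rightarrow> 'b::comm_ring_1" where
  "cut_sum n z a = (\<Sum>S\<in>Pow {..<n}. minor (pencil z (signed_cut a S)) {..<n})"

lemma cut_sum_cong:
  assumes "\<And>i. i < n \<Longrightarrow> z i = z' i" "\<And>i j. i < n \<Longrightarrow> j < n \<Longrightarrow> a i j = a' i j"
  shows "cut_sum n z a = cut_sum n z' a'"
  unfolding cut_sum_def
  by (intro sum.cong minor_cong refl) (auto simp: pencil_def signed_cut_def assms)

lemma (in comm_ring_hom) hom_cut_sum:
  "hom (cut_sum n z a) = cut_sum n (\<lambda>i. hom (z i)) (\<lambda>i j. hom (a i j))"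
  unfolding cut_sum_def hom_sum hom_minor
  by (intro sum.cong minor_cong refl) (simp add: pencil_def signed_cut_def hom_distribs)

lemma poly_cut_sum:
  "poly (cut_sum n z a) x = cut_sum n (\<lambda>i. poly (z i) x) (\<lambda>i j. poly (a i j) x)"
  unfolding cut_sum_def poly_sum poly_minor
  by (intro sum.cong minor_cong refl) (simp add: pencil_def signed_cut_def)

text \<open>The factor 2 arises because index \<open>n\<close> may lie on either side of the cut and
  both choices leave the same minor on \<open>{..<n}\<close>.\<close>

lemma cut_sum_Suc:
  "cut_sum (Suc n) z a = 2 * z n * cut_sum n z a + cut_sum (Suc n) (z(n := 0)) a"
proof -
  have *: "minor (pencil z (signed_cut a S)) {..<Suc n} = z n * minor (pencil z (signed_cut a S)) {..<n} +
      minor (pencil (z(n := 0)) (signed_cut a S)) {..<Suc n}" for S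
    using minor_pencil_update[of "{..<n}" n z "z n" "signed_cut a S"] by (simp add: lessThan_Suc)
  have "minor (pencil z (signed_cut a (insert n S))) {..<n} = minor (pencil z (signed_cut a S)) {..<n}" for S
    by (intro minor_cong) (auto simp: pencil_def signed_cut_def)
  then have "(\<Sum>S\<in>Pow {..<Suc n}. z n * minor (pencil z (signed_cut a S)) {..<n}) =
      2 * z n * cut_sum n z a"
    unfolding lessThan_Suc cut_sum_def
    by (subst sum_Pow_insert) (auto simp: sum_distrib_left mult_ac simp flip: mult_2)
  then show ?thesis
    unfolding cut_sum_def[of "Suc n"] by (subst *) (simp add: sum.distrib)
qed

lemma cut_sum_nonzero:
  fixes a :: "nat \<Rightarrow> nat \<Rightarrow> real"
  assumes "\<And>i j. i < n \<Longrightarrow> j < n \<Longrightarrow> a i j = a j i" "\<And>i. i < n \<Longrightarrow> Im (z i) > 0"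
  shows "cut_sum n z (\<lambda>i j. of_real (a i j)) \<noteq> 0"
  unfolding cut_sum_def by (rule sum_minor_cut_nonzero) (use assms in auto)

text \<open>Complementing \<open>S\<close> negates the signed cut, hence the whole pencil once the
  variables are negated as well.\<close>

lemma cut_sum_uminus:
  "cut_sum n (\<lambda>i. - z i) a = (-1) ^ n * cut_sum n z a"
proof -
  have "cut_sum n (\<lambda>i. - z i) a =
      (\<Sum>S\<in>Pow {..<n}. minor (pencil (\<lambda>i. - z i) (signed_cut a ({..<n} - S))) {..<n})"
    unfolding cut_sum_def
    by (rule sum.reindex_bij_witness[of _ "\<lambda>S. {..<n} - S" "\<lambda>S. {..<n} - S"]) (auto simp: double_diff)
  also have "\<dots> = (\<Sum>S\<in>Pow {..<n}. (-1) ^ n * minor (pencil z (signed_cut a S)) {..<n})"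
  proof (intro sum.cong refl)
    fix S assume "S \<in> Pow {..<n}"
    then have "minor (pencil (\<lambda>i. - z i) (signed_cut a ({..<n} - S))) {..<n} =
        minor (\<lambda>i j. - pencil z (signed_cut a S) i j) {..<n}"
      by (intro minor_cong) (auto simp: pencil_def signed_cut_def)
    then show "minor (pencil (\<lambda>i. - z i) (signed_cut a ({..<n} - S))) {..<n} =
        (-1) ^ n * minor (pencil z (signed_cut a S)) {..<n}"
      by (simp add: minor_uminus)
  qed
  finally show ?thesis by (simp add: cut_sum_def sum_distrib_left)
qed

section \<open>The univariate polynomials \<open>P\<close> and \<open>Q\<close>\<close>

lemma minor_pencil_char_poly:
  "minor (pencil (\<lambda>_. [:0, 1:]) (\<lambda>i j. [:a i j:])) {..<n} = char_poly (mat n n (\<lambda>(i, j). a i j))"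
proof -
  have "char_poly_matrix (mat n n (\<lambda>(i, j). a i j)) =
      mat n n (\<lambda>(i, j). pencil (\<lambda>_. [:0, 1:]) (\<lambda>i j. [:a i j:]) i j)"
    by (rule eq_matI) (auto simp: char_poly_matrix_def pencil_def)
  then show ?thesis by (simp add: char_poly_def det_mat)
qed

lemma cut_const_poly: "signed_cut (\<lambda>i j. [:a i j:]) S = (\<lambda>i j. [:signed_cut a S i j:])"
  by (intro ext) (simp add: signed_cut_def)

text \<open>The polynomial \<open>P\<close>, that is, the mixed determinantal polynomial without its
  factor \<open>1 / 2 ^ n\<close>.\<close>

definition cut_poly :: "nat \<Rightarrow> (nat \<Rightarrow> nat \<Rightarrow> real) \<Rightarrow> real poly" where
  "cut_poly n a = cut_sum n (\<lambda>_. [:0, 1:]) (\<lambda>i j. [:a i j:])"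

lemma poly_cut_poly: "poly (cut_poly n a) x = cut_sum n (\<lambda>_. x) a"
  by (simp add: cut_poly_def poly_cut_sum)

lemma poly_cpoly_cut_poly:
  "poly (cpoly (cut_poly n a)) z = cut_sum n (\<lambda>_. z) (\<lambda>i j. of_real (a i j))"
  unfolding cut_poly_def of_real_poly_hom.hom_cut_sum poly_cut_sum
  by (intro cut_sum_cong) (auto simp: of_real_hom.map_poly_pCons_hom)

lemma degree_cut_poly: "degree (cut_poly n a) = n" "cut_poly n a \<noteq> 0"
proof -
  have eq: "cut_poly n a = (\<Sum>S\<in>Pow {..<n}. char_poly (mat n n (\<lambda>(i, j). signed_cut a S i j)))"
    by (simp add: cut_poly_def cut_sum_def cut_const_poly minor_pencil_char_poly)
  have deg: "degree (char_poly (mat n n (\<lambda>(i, j). signed_cut a S i j))) = n"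
    "coeff (char_poly (mat n n (\<lambda>(i, j). signed_cut a S i j))) n = 1" for S
    using degree_monic_char_poly[of "mat n n (\<lambda>(i, j). signed_cut a S i j)" n] by auto
  have "coeff (cut_poly n a) n = 2 ^ n"
    by (simp add: eq coeff_sum deg card_Pow)
  moreover have "degree (cut_poly n a) \<le> n"
    unfolding eq by (intro degree_sum_le) (auto simp: deg)
  moreover from calculation(1) have "n \<le> degree (cut_poly n a)" by (intro le_degree) simp
  ultimately show "degree (cut_poly n a) = n" "cut_poly n a \<noteq> 0"
    by auto
qed

definition border :: "nat \<Rightarrow> (nat \<Rightarrow> nat \<Rightarrow> 'b) \<Rightarrow> (nat \<Rightarrow> 'b) \<Rightarrow> nat \<Rightarrow> nat \<Rightarrow> 'b::zero" where
  "border n a b i j = (if i < n \<and> j < n then a i j else if i < n then b i else if j < n then b j else 0)"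

text \<open>The polynomial \<open>Q\<close>. The sign comes from the Schur complement: with corner
  0, the bordered determinant is minus the determinant of \<open>x I - X_S\<close> times the
  quadratic form of its inverse at \<open>b\<close>.\<close>

definition border_poly :: "nat \<Rightarrow> (nat \<Rightarrow> nat \<Rightarrow> real) \<Rightarrow> (nat \<Rightarrow> real) \<Rightarrow> real poly" where
  "border_poly n a b = - cut_sum (Suc n) ((\<lambda>_. [:0, 1:])(n := 0)) (\<lambda>i j. [:border n a b i j:])"

lemma poly_border_poly:
  "poly (border_poly n a b) x = - cut_sum (Suc n) ((\<lambda>_. x)(n := 0)) (border n a b)"
  unfolding border_poly_def poly_minus poly_cut_sum
  by (intro arg_cong[of _ _ uminus] cut_sum_cong) auto

lemma poly_cpoly_border_poly:
  "poly (cpoly (border_poly n a b)) z =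
    - cut_sum (Suc n) ((\<lambda>_. z)(n := 0)) (\<lambda>i j. of_real (border n a b i j))"
  unfolding border_poly_def of_real_poly_hom.hom_uminus poly_minus of_real_poly_hom.hom_cut_sum poly_cut_sum
  by (intro arg_cong[of _ _ uminus] cut_sum_cong) (auto simp: of_real_hom.map_poly_pCons_hom)

text \<open>The corner entry is 0, so a contributing permutation sends some \<open>k < n\<close> to
  \<open>n\<close>. Neither row \<open>k\<close> nor row \<open>n\<close> then supplies a linear
  factor, which leaves at most \<open>n - 1\<close> of them.\<close>

lemma degree_border_poly:
  assumes "n > 0"
  shows "degree (border_poly n a b) < n"
proof -
  let ?M = "\<lambda>S. pencil ((\<lambda>_. [:0, 1:])(n := 0)) (signed_cut (\<lambda>i j. [:border n a b i j:]) S)"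
  have prod: "degree (\<Prod>i<Suc n. ?M S i (\<pi> i)) \<le> n - 1" if \<pi>: "\<pi> permutes {..<Suc n}" for S \<pi>
  proof (cases "\<pi> n = n")
    case True
    then have "?M S n (\<pi> n) = 0" by (auto simp: pencil_def signed_cut_def border_def)
    then have "(\<Prod>i<Suc n. ?M S i (\<pi> i)) = 0" by (intro prod_zero) auto
    then show ?thesis by (simp only: degree_0 le0)
  next
    case False
    have "n \<in> \<pi> ` {..<Suc n}" using permutes_image[OF \<pi>] by simp
    then obtain k where k: "k < n" "\<pi> k = n" using False by (auto simp: less_Suc_eq)
    have entry: "degree (?M S i j) \<le> of_bool (i = j \<and> i < n)" if "i < Suc n" for i j
      using that by (auto simp: pencil_def cut_const_poly)
    have "degree (\<Prod>i<Suc n. ?M S i (\<pi> i)) \<le> (\<Sum>i<Suc n. degree (?M S i (\<pi> i)))"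
      by (rule order.trans[OF degree_prod_sum_le]) auto
    also have "\<dots> \<le> (\<Sum>i<Suc n. of_bool (i \<in> {..<n} - {k}))"
    proof (intro sum_mono)
      fix i assume "i \<in> {..<Suc n}"
      then have "degree (?M S i (\<pi> i)) \<le> of_bool (i = \<pi> i \<and> i < n)" using entry by simp
      also have "\<dots> \<le> of_bool (i \<in> {..<n} - {k})" using k by auto
      finally show "degree (?M S i (\<pi> i)) \<le> of_bool (i \<in> {..<n} - {k})" .
    qed
    also have "\<dots> = card ({..<Suc n} \<inter> ({..<n} - {k}))"
      by (subst card_eq_sum, subst sum.inter_restrict) (simp_all only: of_bool_def finite_lessThan)
    also have "{..<Suc n} \<inter> ({..<n} - {k}) = {..<n} - {k}" by auto
    also have "card ({..<n} - {k}) = n - 1" using k by simp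
    finally show ?thesis .
  qed
  have "degree (border_poly n a b) \<le> n - 1"
    unfolding border_poly_def degree_minus cut_sum_def minor_def
  proof (intro degree_sum_le)
    fix S \<pi> assume "\<pi> \<in> {\<pi>. \<pi> permutes {..<Suc n}}"
    then have "degree (\<Prod>i<Suc n. ?M S i (\<pi> i)) \<le> n - 1" using prod by blast
    then show "degree (of_int (sign \<pi>) * (\<Prod>i<Suc n. ?M S i (\<pi> i))) \<le> n - 1"
      by (simp add: sign_def)
  qed (auto intro: finite_permutations)
  then show ?thesis using assms by simp
qed

lemma linear_system_solvable:
  fixes M :: "nat \<Rightarrow> nat \<Rightarrow> 'b::field"
  assumes "minor M {..<n} \<noteq> 0"
  shows "\<exists>u. \<forall>i<n. (\<Sum>j<n. M i j * u j) = b i"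
proof -
  let ?A = "mat n n (\<lambda>(i, j). M i j)"
  have A: "?A \<in> carrier_mat n n" by simp
  have "det ?A \<noteq> 0" using assms by (simp add: det_mat)
  then have "?A \<in> Units (ring_mat TYPE('b) n ())"
    by (rule det_non_zero_imp_unit[OF A])
  then obtain B where B: "B \<in> carrier_mat n n" "?A * B = 1\<^sub>m n"
    by (auto simp: Units_def ring_mat_def)
  let ?u = "B *\<^sub>v vec n b"
  have u: "?u \<in> carrier_vec n" using B(1) by auto
  have "?A *\<^sub>v ?u = vec n b"
    using assoc_mult_mat_vec[OF A B(1), of "vec n b"] B(2) by simp
  then have "(?A *\<^sub>v ?u) $ i = b i" if "i < n" for i using that by simp
  then have "(\<Sum>j<n. M i j * ?u $ j) = b i" if "i < n" for i
    using that u by (simp add: scalar_prod_def lessThan_atLeast0 del: index_mult_mat_vec(1)) 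
      (use that u B(1) in \<open>auto simp: scalar_prod_def lessThan_atLeast0 row_def\<close>)
  then show ?thesis by blast
qed

text \<open>Orthogonality of independent random signs: for \<open>i \<noteq> j\<close>, toggling the
  membership of \<open>i\<close> flips the summand.\<close>

lemma sum_signs:
  fixes V :: "'a set"
  assumes "finite V" "i \<in> V" "j \<in> V"
  shows "(\<Sum>S\<in>Pow V. (if i \<in> S then 1 else -1) * (if j \<in> S then 1 else -1 :: real)) =
    (if i = j then 2 ^ card V else 0)"
proof (cases "i = j")
  case True
  then have "(\<Sum>S\<in>Pow V. (if i \<in> S then 1 else -1) * (if j \<in> S then 1 else -1 :: real)) =
      (\<Sum>S\<in>Pow V. 1)"
    by (intro sum.cong) auto
  then show ?thesis using True assms by (simp add: card_Pow)
next
  case False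
  define U where "U = V - {i}"
  have V: "V = insert i U" "finite U" "i \<notin> U" using assms by (auto simp: U_def)
  show ?thesis
    unfolding V(1) sum_Pow_insert[OF V(2,3)]
    by (rule trans[OF sum.neutral]) (use V(3) False in auto)
qed

section \<open>Symmetric zero-diagonal matrices and the quotient of \<open>Q\<close> by
  \<open>P\<close>\<close>

locale symmetric_form =
  fixes n :: nat and a :: "nat \<Rightarrow> nat \<Rightarrow> real"
  assumes sym: "\<And>i j. i < n \<Longrightarrow> j < n \<Longrightarrow> a i j = a j i"
    and diag: "\<And>i. i < n \<Longrightarrow> a i i = 0"
begin

text \<open>With corner variable \<open>w\<close> the bordered cut sum is
  \<open>2 * w * P - Q\<close>. A quotient in the open upper half-plane would give a zero
  \<open>w\<close> there, against stability.\<close>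

lemma border_poly_pick:
  assumes "Im z > 0"
  shows "poly (cpoly (cut_poly n a)) z \<noteq> 0 \<and>
    Im (poly (cpoly (border_poly n a b)) z / poly (cpoly (cut_poly n a)) z) \<le> 0"
proof -
  let ?P = "poly (cpoly (cut_poly n a)) z" and ?Q = "poly (cpoly (border_poly n a b)) z"
  have P: "?P \<noteq> 0"
    unfolding poly_cpoly_cut_poly by (rule cut_sum_nonzero) (use sym assms in auto)
  moreover have "Im (?Q / ?P) \<le> 0"
  proof (rule ccontr)
    assume neg: "\<not> Im (?Q / ?P) \<le> 0"
    define w where "w = ?Q / ?P / 2"
    have "Im w > 0" using neg unfolding w_def by (simp only: Im_divide_numeral)
    have "cut_sum (Suc n) ((\<lambda>_. z)(n := w)) (\<lambda>i j. of_real (border n a b i j)) \<noteq> 0"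
      by (rule cut_sum_nonzero) (use sym assms \<open>Im w > 0\<close> in \<open>auto simp: border_def\<close>)
    moreover have "cut_sum (Suc n) ((\<lambda>_. z)(n := w)) (\<lambda>i j. of_real (border n a b i j)) = 2 * w * ?P - ?Q"
    proof -
      have "cut_sum n ((\<lambda>_. z)(n := w)) (\<lambda>i j. of_real (border n a b i j)) = ?P"
        unfolding poly_cpoly_cut_poly by (intro cut_sum_cong) (auto simp: border_def)
      then show ?thesis
        by (subst cut_sum_Suc) (simp add: poly_cpoly_border_poly)
    qed
    ultimately show False using P by (simp add: w_def)
  qed
  ultimately show ?thesis by simp
qed

text \<open>\<open>cut_sum_uminus\<close> on \<open>n\<close> and on \<open>n + 1\<close> indices
  gives \<open>P\<close> and \<open>Q\<close> opposite parity.\<close>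

lemma border_poly_odd:
  "poly (border_poly n a b) (- x) / poly (cut_poly n a) (- x) =
    - (poly (border_poly n a b) x / poly (cut_poly n a) x)"
proof -
  have "poly (cut_poly n a) (- x) = (-1) ^ n * poly (cut_poly n a) x"
    unfolding poly_cut_poly using cut_sum_uminus[of n "\<lambda>_. x" a] by simp
  moreover have "poly (border_poly n a b) (- x) = - ((-1) ^ n * poly (border_poly n a b) x)"
  proof -
    have "cut_sum (Suc n) ((\<lambda>_. - x)(n := 0)) (border n a b) =
        cut_sum (Suc n) (\<lambda>i. - ((\<lambda>_. x)(n := 0)) i) (border n a b)"
      by (intro cut_sum_cong) auto
    then show ?thesis
      unfolding poly_border_poly using cut_sum_uminus[of "Suc n" "(\<lambda>_. x)(n := 0)" "border n a b"] by simp
  qed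
  ultimately show ?thesis by simp
qed

text \<open>For each \<open>S\<close> the new index \<open>n\<close> lies on one of the two sides; the two Schur complements add up
  because the pencil is block diagonal.\<close>

lemma border_poly_resolvent:
  assumes u: "\<And>S i. S \<subseteq> {..<n} \<Longrightarrow> i < n \<Longrightarrow>
    (\<Sum>j<n. pencil (\<lambda>_. x) (signed_cut a S) i j * u S j) = b i"
  shows "poly (border_poly n a b) x =
    (\<Sum>S\<in>Pow {..<n}. minor (pencil (\<lambda>_. x) (signed_cut a S)) {..<n} * (\<Sum>j<n. b j * u S j))"
proof -
  let ?z = "(\<lambda>_. x)(n := 0)"
  let ?D = "\<lambda>S. minor (pencil (\<lambda>_. x) (signed_cut a S)) {..<n}"
  let ?N = "\<lambda>S. pencil ?z (signed_cut (border n a b) S)"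
  \<comment> \<open>The pencil has no entries across the cut, so restricting \<open>u S\<close> to
    one side (\<open>t\<close> selects it) solves the system for \<open>b\<close> restricted to that
    side.\<close>
  have block: "(\<Sum>j<n. pencil (\<lambda>_. x) (signed_cut a S) i j * (of_bool (j \<in> S = t) * u S j)) =
      of_bool (i \<in> S = t) * b i" if S: "S \<subseteq> {..<n}" and i: "i < n" for S i t
  proof -
    have "(\<Sum>j<n. pencil (\<lambda>_. x) (signed_cut a S) i j * (of_bool (j \<in> S = t) * u S j)) =
        (\<Sum>j<n. of_bool (i \<in> S = t) * (pencil (\<lambda>_. x) (signed_cut a S) i j * u S j))"
      by (intro sum.cong refl) (auto simp: pencil_def signed_cut_def)
    then show ?thesis using u[OF S i] by (simp add: sum_distrib_left[symmetric])
  qed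
  have inner: "minor (?N S) {..<n} = ?D S" "minor (?N (insert n S)) {..<n} = ?D S" for S
    by (intro minor_cong; auto simp: pencil_def signed_cut_def border_def)+
  have out: "minor (?N S) {..<Suc n} = ?D S * (- (\<Sum>j<n. of_bool (j \<notin> S) * (b j * u S j)))"
    if S: "S \<subseteq> {..<n}" for S
  proof -
    have "minor (?N S) {..<Suc n} = minor (?N S) {..<n} *
        (?N S n n - (\<Sum>j<n. ?N S n j * (of_bool (j \<in> S = False) * u S j)))"
    proof (rule minor_schur)
      fix i assume i: "i < n"
      have "(\<Sum>j<n. ?N S i j * (of_bool (j \<in> S = False) * u S j)) =
          (\<Sum>j<n. pencil (\<lambda>_. x) (signed_cut a S) i j * (of_bool (j \<in> S = False) * u S j))"
        using i by (intro sum.cong refl) (auto simp: pencil_def signed_cut_def border_def)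
      also have "\<dots> = ?N S i n"
        unfolding block[OF S i] using i S by (auto simp: pencil_def signed_cut_def border_def)
      finally show "(\<Sum>j<n. ?N S i j * (of_bool (j \<in> S = False) * u S j)) = ?N S i n" .
    qed
    also have "?N S n n - (\<Sum>j<n. ?N S n j * (of_bool (j \<in> S = False) * u S j)) =
        - (\<Sum>j<n. of_bool (j \<notin> S) * (b j * u S j))"
    proof -
      have "(\<Sum>j<n. ?N S n j * (of_bool (j \<in> S = False) * u S j)) =
          (\<Sum>j<n. of_bool (j \<notin> S) * (b j * u S j))"
        using S by (intro sum.cong refl) (auto simp: pencil_def signed_cut_def border_def)
      moreover have "?N S n n = 0" by (auto simp: pencil_def signed_cut_def border_def)
      ultimately show ?thesis by (simp only: diff_0)
    qed
    finally show ?thesis by (simp only: inner(1))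
  qed
  have "in": "minor (?N (insert n S)) {..<Suc n} = ?D S * (- (\<Sum>j<n. of_bool (j \<in> S) * (b j * u S j)))"
    if S: "S \<subseteq> {..<n}" for S
  proof -
    \<comment> \<open>On the side of \<open>S\<close> the border enters the pencil as
      \<open>- b\<close>, on the complement as \<open>b\<close>; hence the sign here, in contrast to
      the previous case.\<close>
    let ?y = "\<lambda>j. - (of_bool (j \<in> S = True) * u S j)"
    have "minor (?N (insert n S)) {..<Suc n} = minor (?N (insert n S)) {..<n} *
        (?N (insert n S) n n - (\<Sum>j<n. ?N (insert n S) n j * ?y j))"
    proof (rule minor_schur)
      fix i assume i: "i < n"
      have "(\<Sum>j<n. ?N (insert n S) i j * ?y j) =
          - (\<Sum>j<n. pencil (\<lambda>_. x) (signed_cut a S) i j * (of_bool (j \<in> S = True) * u S j))"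
        unfolding sum_negf[symmetric]
        using i by (intro sum.cong refl) (auto simp: pencil_def signed_cut_def border_def)
      also have "\<dots> = ?N (insert n S) i n"
        unfolding block[OF S i] using i S by (auto simp: pencil_def signed_cut_def border_def)
      finally show "(\<Sum>j<n. ?N (insert n S) i j * ?y j) = ?N (insert n S) i n" .
    qed
    also have "?N (insert n S) n n - (\<Sum>j<n. ?N (insert n S) n j * ?y j) =
        - (\<Sum>j<n. of_bool (j \<in> S) * (b j * u S j))"
    proof -
      have "(\<Sum>j<n. ?N (insert n S) n j * ?y j) = (\<Sum>j<n. of_bool (j \<in> S) * (b j * u S j))"
        using S by (intro sum.cong refl) (auto simp: pencil_def signed_cut_def border_def)
      moreover have "?N (insert n S) n n = 0" by (auto simp: pencil_def signed_cut_def border_def)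
      ultimately show ?thesis by (simp only: diff_0)
    qed
    finally show ?thesis by (simp only: inner(2))
  qed
  have split: "(\<Sum>j<n. of_bool (j \<notin> S) * (b j * u S j)) + (\<Sum>j<n. of_bool (j \<in> S) * (b j * u S j)) =
      (\<Sum>j<n. b j * u S j)" for S
    unfolding sum.distrib[symmetric] by (intro sum.cong) auto
  have "poly (border_poly n a b) x =
      - (\<Sum>S\<in>Pow {..<n}. minor (?N S) {..<Suc n} + minor (?N (insert n S)) {..<Suc n})"
    unfolding poly_border_poly cut_sum_def lessThan_Suc by (subst sum_Pow_insert) auto
  also have "\<dots> = (\<Sum>S\<in>Pow {..<n}. ?D S * (\<Sum>j<n. b j * u S j))"
    unfolding sum_negf[symmetric] split[symmetric]
    by (intro sum.cong refl) (simp add: out "in" algebra_simps)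
  finally show ?thesis .
qed

section \<open>Moments\<close>

text \<open>With signs \<open>s i\<close> recording the side of \<open>i\<close>, the cut multiplies
  the entry at \<open>k\<close>, \<open>j\<close> by \<open>(s k + s j) / 2\<close>. Expanding the
  square and averaging by \<open>sum_signs\<close> leaves a full square and a diagonal sum, each
  with weight \<open>1 / 4\<close>.\<close>

lemma sum_app_signed_cut_square:
  assumes k: "k < n"
  shows "(\<Sum>S\<in>Pow {..<n}. (\<Sum>j<n. signed_cut a S k j * b j)\<^sup>2) =
    2 ^ n / 4 * ((\<Sum>j<n. a k j * b j)\<^sup>2 + (\<Sum>j<n. (a k j)\<^sup>2 * (b j)\<^sup>2))"
proof -
  define s :: "nat set \<Rightarrow> nat \<Rightarrow> real" where "s S i = (if i \<in> S then 1 else -1)" for S i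
  define c where "c j = a k j * b j" for j
  define C where "C = (\<Sum>j<n. c j)"
  have ss: "(\<Sum>S\<in>Pow {..<n}. s S i * s S j) = (if i = j then 2 ^ n else 0)" if "i < n" "j < n" for i j
    using sum_signs[of "{..<n}" i j] that by (simp add: s_def)
  have ck: "c k = 0" using diag[OF k] by (simp add: c_def)
  have entry: "signed_cut a S k j * b j = (s S k * c j + s S j * c j) / 2" for S j
    by (auto simp: signed_cut_def s_def c_def)
  have square: "(\<Sum>j<n. signed_cut a S k j * b j)\<^sup>2 =
      (C\<^sup>2 + 2 * C * (\<Sum>j<n. c j * (s S k * s S j)) + (\<Sum>i<n. \<Sum>j<n. c i * c j * (s S i * s S j))) / 4" for S
  proof -
    have sk: "(s S k)\<^sup>2 = 1" by (simp add: s_def)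
    have "(\<Sum>j<n. signed_cut a S k j * b j) = (s S k * C + (\<Sum>j<n. s S j * c j)) / 2"
      by (simp add: entry sum_divide_distrib[symmetric] sum.distrib C_def sum_distrib_left)
    then have "(\<Sum>j<n. signed_cut a S k j * b j)\<^sup>2 = ((s S k * C + (\<Sum>j<n. s S j * c j)) / 2)\<^sup>2"
      by (simp only:)
    also have "\<dots> = ((s S k)\<^sup>2 * C\<^sup>2 + 2 * C * (s S k * (\<Sum>j<n. s S j * c j)) + (\<Sum>j<n. s S j * c j)\<^sup>2) / 4"
      by (simp add: power2_eq_square field_simps)
    finally have "(\<Sum>j<n. signed_cut a S k j * b j)\<^sup>2 =
        ((s S k)\<^sup>2 * C\<^sup>2 + 2 * C * (s S k * (\<Sum>j<n. s S j * c j)) + (\<Sum>j<n. s S j * c j)\<^sup>2) / 4" .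
    moreover have "s S k * (\<Sum>j<n. s S j * c j) = (\<Sum>j<n. c j * (s S k * s S j))"
      unfolding sum_distrib_left by (intro sum.cong) (auto simp: mult_ac)
    moreover have "(\<Sum>j<n. s S j * c j)\<^sup>2 = (\<Sum>i<n. \<Sum>j<n. c i * c j * (s S i * s S j))"
      unfolding power2_eq_square sum_product by (intro sum.cong refl) (simp add: mult_ac)
    ultimately show ?thesis by (simp only: sk mult_1)
  qed
  \<comment> \<open>Only \<open>j = k\<close> survives the averaging, and there the zero diagonal
    gives \<open>c k = 0\<close>.\<close>
  have cross: "(\<Sum>S\<in>Pow {..<n}. \<Sum>j<n. c j * (s S k * s S j)) = 0"
  proof -
    have "(\<Sum>S\<in>Pow {..<n}. \<Sum>j<n. c j * (s S k * s S j)) = (\<Sum>j<n. c j * (\<Sum>S\<in>Pow {..<n}. s S k * s S j))"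
      by (subst sum.swap) (simp add: sum_distrib_left)
    also have "\<dots> = (\<Sum>j<n. if j = k then c k * 2 ^ n else 0)"
      by (intro sum.cong) (auto simp: ss k)
    finally show ?thesis using ck by simp
  qed
  have quad: "(\<Sum>S\<in>Pow {..<n}. \<Sum>i<n. \<Sum>j<n. c i * c j * (s S i * s S j)) = 2 ^ n * (\<Sum>i<n. (c i)\<^sup>2)"
  proof -
    have "(\<Sum>S\<in>Pow {..<n}. \<Sum>i<n. \<Sum>j<n. c i * c j * (s S i * s S j)) =
        (\<Sum>i<n. \<Sum>j<n. c i * c j * (\<Sum>S\<in>Pow {..<n}. s S i * s S j))"
      unfolding sum_distrib_left by (subst sum.swap, intro sum.cong refl, rule sum.swap)
    also have "\<dots> = (\<Sum>i<n. \<Sum>j<n. if j = i then 2 ^ n * (c i)\<^sup>2 else 0)"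
      by (intro sum.cong refl) (auto simp: ss power2_eq_square)
    finally show ?thesis by (simp add: sum_distrib_left)
  qed
  have "(\<Sum>S\<in>Pow {..<n}. (\<Sum>j<n. signed_cut a S k j * b j)\<^sup>2) =
      ((\<Sum>S\<in>Pow {..<n}. C\<^sup>2) + 2 * C * (\<Sum>S\<in>Pow {..<n}. \<Sum>j<n. c j * (s S k * s S j)) +
        (\<Sum>S\<in>Pow {..<n}. \<Sum>i<n. \<Sum>j<n. c i * c j * (s S i * s S j))) / 4"
    unfolding square sum_divide_distrib[symmetric] sum.distrib sum_distrib_left[symmetric] ..
  also have "\<dots> = 2 ^ n / 4 * (C\<^sup>2 + (\<Sum>i<n. (c i)\<^sup>2))"
    unfolding cross quad by (simp add: card_Pow algebra_simps add_divide_distrib)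
  finally show ?thesis by (simp add: C_def c_def power_mult_distrib)
qed

lemma signed_cut_sym: "i < n \<Longrightarrow> j < n \<Longrightarrow> signed_cut a S i j = signed_cut a S j i"
  using sym by (auto simp: signed_cut_def)

lemma signed_cut_diag: "i < n \<Longrightarrow> signed_cut a S i i = 0"
  using diag by (auto simp: signed_cut_def)

text \<open>A non-identity permutation moves both some \<open>i\<close> and its image
  \<open>j\<close>. The two factors are of order \<open>1 / x\<close> each, so one absorbs the extra
  \<open>x\<close> and the other still tends to 0.\<close>

lemma permutation_term_tendsto_0:
  assumes \<pi>: "\<pi> permutes {..<n}" "\<pi> \<noteq> id"
  shows "((\<lambda>x. x * (\<Prod>i<n. pencil (\<lambda>_. x) (signed_cut a S) i (\<pi> i) / x)) \<longlongrightarrow> 0) at_top"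
proof -
  let ?f = "\<lambda>x i. pencil (\<lambda>_. x) (signed_cut a S) i (\<pi> i) / x"
  obtain i where i: "\<pi> i \<noteq> i" using \<pi>(2) by (auto simp: fun_eq_iff)
  define j where "j = \<pi> i"
  have "i \<in> {..<n}" using i permutes_not_in[OF \<pi>(1), of i] by blast
  moreover from this have "\<pi> i \<in> {..<n}" using permutes_in_image[OF \<pi>(1)] by blast
  ultimately have ij: "i < n" "j < n" "i \<noteq> j" using i by (simp_all add: j_def)
  have j: "\<pi> j \<noteq> j" using i permutes_inj[OF \<pi>(1)] by (auto simp: j_def inj_eq)
  have lim: "((\<lambda>x. ?f x k) \<longlongrightarrow> of_bool (\<pi> k = k)) at_top" for k
  proof (cases "\<pi> k = k")
    case True
    have "((\<lambda>x. (x - c) / x) \<longlongrightarrow> 1) at_top" for c :: real by real_asymp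
    then show ?thesis using True by (simp add: pencil_def)
  next
    case False
    have "((\<lambda>x. - c / x) \<longlongrightarrow> 0) at_top" for c :: real by real_asymp
    from this[of "signed_cut a S k (\<pi> k)"] show ?thesis using False by (simp add: pencil_def)
  qed
  have xf: "((\<lambda>x. x * ?f x i) \<longlongrightarrow> - signed_cut a S i j) at_top"
  proof -
    have "((\<lambda>x. x * (- c / x)) \<longlongrightarrow> - c) at_top" for c :: real by real_asymp
    from this[of "signed_cut a S i j"] show ?thesis using i by (simp add: pencil_def j_def)
  qed
  have "((\<lambda>x. (\<Prod>k\<in>{..<n} - {i, j}. ?f x k) * ((x * ?f x i) * ?f x j)) \<longlongrightarrow>
      (\<Prod>k\<in>{..<n} - {i, j}. of_bool (\<pi> k = k)) * (- signed_cut a S i j * of_bool (\<pi> j = j))) at_top"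
    by (intro tendsto_mult tendsto_prod lim xf)
  moreover have "x * (\<Prod>k<n. ?f x k) = (\<Prod>k\<in>{..<n} - {i, j}. ?f x k) * ((x * ?f x i) * ?f x j)" for x
  proof -
    have "(\<Prod>k<n. ?f x k) = (\<Prod>k\<in>{..<n} - {i, j}. ?f x k) * (\<Prod>k\<in>{i, j}. ?f x k)"
      using ij by (intro prod.subset_diff) auto
    then show ?thesis using ij by (simp add: mult_ac)
  qed
  ultimately show ?thesis using j by simp
qed

text \<open>The determinant is \<open>x ^ n * (1 + o(1 / x))\<close>: as the diagonal is zero, the
  identity contributes exactly \<open>x ^ n\<close>. This precision is needed because first moments,
  multiplied by \<open>x\<close>, appear later.\<close>

lemma minor_normalized_tendsto:
  shows "((\<lambda>x. x * (minor (pencil (\<lambda>_. x) (signed_cut a S)) {..<n} / x ^ n - 1)) \<longlongrightarrow> 0) at_top"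
    and "((\<lambda>x. minor (pencil (\<lambda>_. x) (signed_cut a S)) {..<n} / x ^ n) \<longlongrightarrow> 1) at_top"
proof -
  let ?d = "\<lambda>x. minor (pencil (\<lambda>_. x) (signed_cut a S)) {..<n} / x ^ n"
  let ?P = "{\<pi>. \<pi> permutes {..<n}}"
  let ?t = "\<lambda>x \<pi>. \<Prod>i<n. pencil (\<lambda>_. x) (signed_cut a S) i (\<pi> i) / x"
  have fin: "finite ?P" by (simp add: finite_permutations)
  have expand: "?d x - 1 = (\<Sum>\<pi>\<in>?P - {id}. of_int (sign \<pi>) * ?t x \<pi>)" if "x > 0" for x
  proof -
    have "?d x = (\<Sum>\<pi>\<in>?P. of_int (sign \<pi>) * ?t x \<pi>)"
      by (simp add: minor_def sum_divide_distrib prod_dividef)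
    also have "\<dots> = of_int (sign (id :: nat \<Rightarrow> nat)) * ?t x id + (\<Sum>\<pi>\<in>?P - {id}. of_int (sign \<pi>) * ?t x \<pi>)"
      by (rule sum.remove[OF fin, of id "\<lambda>\<pi>. of_int (sign \<pi>) * ?t x \<pi>"]) (simp add: permutes_id)
    also have "?t x id = 1"
      using that by (intro prod.neutral) (auto simp: pencil_def signed_cut_diag)
    finally show ?thesis by (simp only: sign_id of_int_1 mult_1 add_diff_cancel_left')
  qed
  have "((\<lambda>x. \<Sum>\<pi>\<in>?P - {id}. of_int (sign \<pi>) * (x * ?t x \<pi>)) \<longlongrightarrow> (\<Sum>\<pi>\<in>?P - {id}. of_int (sign \<pi>) * 0)) at_top"
    by (intro tendsto_sum tendsto_mult tendsto_const permutation_term_tendsto_0) auto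
  moreover have "eventually (\<lambda>x. (\<Sum>\<pi>\<in>?P - {id}. of_int (sign \<pi>) * (x * ?t x \<pi>)) = x * (?d x - 1)) at_top"
    using eventually_gt_at_top[of 0]
  proof eventually_elim
    case (elim x)
    show ?case unfolding expand[OF elim] sum_distrib_left by (intro sum.cong refl) (simp only: mult.left_commute)
  qed
  ultimately show lim: "((\<lambda>x. x * (?d x - 1)) \<longlongrightarrow> 0) at_top"
    by (simp add: tendsto_cong)
  have "((\<lambda>x::real. 1 / x) \<longlongrightarrow> 0) at_top" by real_asymp
  then have "((\<lambda>x. 1 / x * (x * (?d x - 1)) + 1) \<longlongrightarrow> 0 * 0 + 1) at_top"
    by (intro tendsto_intros lim)
  moreover have "eventually (\<lambda>x. 1 / x * (x * (?d x - 1)) + 1 = ?d x) at_top"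
    using eventually_gt_at_top[of 0] by eventually_elim simp
  ultimately show "(?d \<longlongrightarrow> 1) at_top"
    using Lim_transform_eventually by force
qed

section \<open>Expansion of the resolvent at infinity\<close>

definition app :: "nat set \<Rightarrow> (nat \<Rightarrow> real) \<Rightarrow> nat \<Rightarrow> real" where
  "app S w i = (\<Sum>j<n. signed_cut a S i j * w j)"

lemma app_adjoint: "(\<Sum>i<n. v i * app S w i) = (\<Sum>i<n. app S v i * w i)"
proof -
  have "(\<Sum>i<n. v i * app S w i) = (\<Sum>i<n. \<Sum>j<n. v i * (signed_cut a S i j * w j))"
    by (simp add: app_def sum_distrib_left)
  also have "\<dots> = (\<Sum>j<n. \<Sum>i<n. v i * (signed_cut a S i j * w j))" by (rule sum.swap)
  also have "\<dots> = (\<Sum>j<n. app S v j * w j)"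
    unfolding app_def sum_distrib_right
    by (intro sum.cong refl) (auto simp: signed_cut_sym[of _ _ S])
  finally show ?thesis .
qed

lemma pencil_app:
  assumes "i < n"
  shows "(\<Sum>j<n. pencil (\<lambda>_. x) (signed_cut a S) i j * u j) = x * u i - app S u i"
proof -
  have "(\<Sum>j<n. pencil (\<lambda>_. x) (signed_cut a S) i j * u j) =
      (\<Sum>j<n. if j = i then x * u i else 0) - app S u i"
    unfolding app_def sum_subtractf[symmetric]
    by (intro sum.cong) (auto simp: pencil_def algebra_simps)
  then show ?thesis using assms by simp
qed

text \<open>Here \<open>u x\<close> is the resolvent applied to \<open>b\<close>. Pairing its
  equation with \<open>w\<close> and moving the matrix across by symmetry gives
  \<open>x * g w x = <w, b> + g (app S w) x\<close>. Three iterations from \<open>w = b\<close>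
  produce the moments of order 0, 1, 2 and a vanishing remainder.\<close>

lemma resolvent_expansion:
  assumes ev: "eventually (\<lambda>x. \<forall>i<n. x * u x i - app S (u x) i = b i) at_top"
  shows "((\<lambda>x. x * (x * (x * (\<Sum>i<n. b i * u x i))) - x * (x * (\<Sum>i<n. (b i)\<^sup>2)) -
      x * (\<Sum>i<n. b i * app S b i)) \<longlongrightarrow> (\<Sum>i<n. (app S b i)\<^sup>2)) at_top"
    and "((\<lambda>x. x * (\<Sum>i<n. b i * u x i)) \<longlongrightarrow> (\<Sum>i<n. (b i)\<^sup>2)) at_top"
proof -
  define g where "g w x = (\<Sum>i<n. w i * u x i)" for w x
  define B C where "B = (\<Sum>i<n. \<bar>b i\<bar>)" and "C = (\<Sum>j<n. \<Sum>i<n. \<bar>signed_cut a S i j\<bar>)"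
  have rec: "eventually (\<lambda>x. \<forall>w. x * g w x = (\<Sum>i<n. w i * b i) + g (app S w) x) at_top"
    using ev
  proof eventually_elim
    case (elim x)
    show ?case
    proof
      fix w
      have "x * g w x = (\<Sum>i<n. w i * (b i + app S (u x) i))"
        unfolding g_def sum_distrib_left
      proof (intro sum.cong refl)
        fix i assume "i \<in> {..<n}"
        then have "x * u x i = b i + app S (u x) i" using elim by force
        then show "x * (w i * u x i) = w i * (b i + app S (u x) i)" by (metis mult.left_commute)
      qed
      also have "\<dots> = (\<Sum>i<n. w i * b i) + g (app S w) x"
        unfolding g_def app_adjoint[symmetric] by (simp add: algebra_simps sum.distrib)
      finally show "x * g w x = (\<Sum>i<n. w i * b i) + g (app S w) x" .
    qed
  qed
  \<comment> \<open>\<open>C\<close> dominates every absolute column sum, so the 1-norm of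
    \<open>u x\<close> satisfies \<open>x * |u| \<le> B + C * |u|\<close>.\<close>
  have bound: "eventually (\<lambda>x. (\<Sum>i<n. \<bar>u x i\<bar>) \<le> B / (x - C)) at_top"
    using ev eventually_gt_at_top[of C] eventually_gt_at_top[of 0]
  proof eventually_elim
    case (elim x)
    have "x * (\<Sum>i<n. \<bar>u x i\<bar>) = (\<Sum>i<n. \<bar>b i + app S (u x) i\<bar>)"
      unfolding sum_distrib_left
    proof (intro sum.cong refl)
      fix i assume "i \<in> {..<n}"
      then have "b i + app S (u x) i = x * u x i" using elim by force
      then show "x * \<bar>u x i\<bar> = \<bar>b i + app S (u x) i\<bar>" using elim by (simp add: abs_mult)
    qed
    also have "\<dots> \<le> (\<Sum>i<n. \<bar>b i\<bar> + (\<Sum>j<n. \<bar>signed_cut a S i j\<bar> * \<bar>u x j\<bar>))"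
    proof (intro sum_mono)
      fix i
      have "\<bar>app S (u x) i\<bar> \<le> (\<Sum>j<n. \<bar>signed_cut a S i j\<bar> * \<bar>u x j\<bar>)"
        unfolding app_def abs_mult[symmetric] by (rule sum_abs)
      then show "\<bar>b i + app S (u x) i\<bar> \<le> \<bar>b i\<bar> + (\<Sum>j<n. \<bar>signed_cut a S i j\<bar> * \<bar>u x j\<bar>)" by linarith
    qed
    also have "\<dots> = B + (\<Sum>j<n. (\<Sum>i<n. \<bar>signed_cut a S i j\<bar>) * \<bar>u x j\<bar>)"
      unfolding sum.distrib B_def sum_distrib_right by (subst sum.swap) simp
    also have "(\<Sum>j<n. (\<Sum>i<n. \<bar>signed_cut a S i j\<bar>) * \<bar>u x j\<bar>) \<le> (\<Sum>j<n. C * \<bar>u x j\<bar>)"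
    proof (intro sum_mono mult_right_mono)
      fix j assume "j \<in> {..<n}"
      then show "(\<Sum>i<n. \<bar>signed_cut a S i j\<bar>) \<le> C"
        unfolding C_def by (intro member_le_sum) (auto intro: sum_nonneg)
    qed simp
    finally have "(\<Sum>i<n. \<bar>u x i\<bar>) * (x - C) \<le> B"
      by (simp add: sum_distrib_left[symmetric] algebra_simps)
    then show ?case using elim by (simp add: pos_le_divide_eq)
  qed
  have g0: "(g w \<longlongrightarrow> 0) at_top" for w
  proof -
    define W where "W = (\<Sum>i<n. \<bar>w i\<bar>)"
    have "((\<lambda>x. W * (B / (x - C))) \<longlongrightarrow> 0) at_top" by real_asymp
    moreover have "eventually (\<lambda>x. norm (g w x) \<le> W * (B / (x - C))) at_top"
      using bound
    proof eventually_elim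
      case (elim x)
      have "norm (g w x) \<le> (\<Sum>i<n. \<bar>w i\<bar> * \<bar>u x i\<bar>)"
        unfolding g_def real_norm_def abs_mult[symmetric] by (rule sum_abs)
      also have "\<dots> \<le> (\<Sum>i<n. W * \<bar>u x i\<bar>)"
        unfolding W_def by (intro sum_mono mult_right_mono member_le_sum) auto
      also have "\<dots> = W * (\<Sum>i<n. \<bar>u x i\<bar>)" by (simp add: sum_distrib_left)
      also have "\<dots> \<le> W * (B / (x - C))"
        using elim by (intro mult_left_mono) (auto simp: W_def sum_nonneg)
      finally show ?case .
    qed
    moreover have "y \<le> norm y * 1" for y :: real by simp
    ultimately show ?thesis
      by (elim tendsto_0_le[of _ _ _ 1] eventually_mono) (rule order.trans)
  qed
  \<comment> \<open>By symmetry the second moment is a squared norm.\<close>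
  have third: "(\<Sum>i<n. app S (app S b) i * b i) = (\<Sum>i<n. (app S b i)\<^sup>2)"
    using app_adjoint[of "app S b" S b] by (simp add: power2_eq_square)
  have second: "(\<Sum>i<n. app S b i * b i) = (\<Sum>i<n. b i * app S b i)" by (simp add: mult.commute)
  have first: "(\<Sum>i<n. b i * b i) = (\<Sum>i<n. (b i)\<^sup>2)" by (simp add: power2_eq_square)
  have "((\<lambda>x. (\<Sum>i<n. (app S b i)\<^sup>2) + g (app S (app S (app S b))) x) \<longlongrightarrow>
      (\<Sum>i<n. (app S b i)\<^sup>2) + 0) at_top"
    by (intro tendsto_intros g0)
  moreover have "eventually (\<lambda>x. (\<Sum>i<n. (app S b i)\<^sup>2) + g (app S (app S (app S b))) x =
      x * (x * (x * g b x)) - x * (x * (\<Sum>i<n. (b i)\<^sup>2)) - x * (\<Sum>i<n. b i * app S b i)) at_top"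
    using rec
  proof eventually_elim
    case (elim x)
    have "x * (x * (x * g b x)) - x * (x * (\<Sum>i<n. (b i)\<^sup>2)) - x * (\<Sum>i<n. b i * app S b i) =
        x * (x * g (app S b) x) - x * (\<Sum>i<n. b i * app S b i)"
      unfolding elim[rule_format, of b] first by (simp add: algebra_simps)
    also have "\<dots> = x * g (app S (app S b)) x"
      unfolding elim[rule_format, of "app S b"] second by (simp add: algebra_simps)
    finally show ?case
      unfolding elim[rule_format, of "app S (app S b)"] third by simp
  qed
  ultimately show "((\<lambda>x. x * (x * (x * (\<Sum>i<n. b i * u x i))) - x * (x * (\<Sum>i<n. (b i)\<^sup>2)) -
      x * (\<Sum>i<n. b i * app S b i)) \<longlongrightarrow> (\<Sum>i<n. (app S b i)\<^sup>2)) at_top"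
    unfolding g_def[of b] using Lim_transform_eventually by force
  have "((\<lambda>x. (\<Sum>i<n. (b i)\<^sup>2) + g (app S b) x) \<longlongrightarrow> (\<Sum>i<n. (b i)\<^sup>2) + 0) at_top"
    by (intro tendsto_intros g0)
  moreover have "eventually (\<lambda>x. (\<Sum>i<n. (b i)\<^sup>2) + g (app S b) x = x * g b x) at_top"
    using rec by eventually_elim (simp add: first)
  ultimately show "((\<lambda>x. x * (\<Sum>i<n. b i * u x i)) \<longlongrightarrow> (\<Sum>i<n. (b i)\<^sup>2)) at_top"
    unfolding g_def[of b] using Lim_transform_eventually by force
qed

lemma app_complement:
  assumes "S \<subseteq> {..<n}" "i < n"
  shows "app ({..<n} - S) w i = - app S w i"
  unfolding app_def sum_negf[symmetric]
  by (intro sum.cong) (use assms in \<open>auto simp: signed_cut_def\<close>)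

text \<open>The contributions of \<open>S\<close> and of its complement cancel.\<close>

lemma sum_first_moment: "(\<Sum>S\<in>Pow {..<n}. \<Sum>i<n. b i * app S b i) = 0"
proof -
  let ?k = "\<lambda>S. \<Sum>i<n. b i * app S b i"
  have "(\<Sum>S\<in>Pow {..<n}. ?k S) = (\<Sum>S\<in>Pow {..<n}. ?k ({..<n} - S))"
    by (rule sum.reindex_bij_witness[of _ "\<lambda>S. {..<n} - S" "\<lambda>S. {..<n} - S"]) (auto simp: double_diff)
  also have "\<dots> = (\<Sum>S\<in>Pow {..<n}. - ?k S)"
    unfolding sum_negf[symmetric] by (intro sum.cong refl) (simp add: app_complement)
  finally show ?thesis by (simp add: sum_negf)
qed

text \<open>The quotient of \<open>border_poly\<close> by \<open>cut_poly\<close> is the Stieltjes transform of a measure on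
  \<open>[-r, r]\<close>; the two sides are \<open>2 ^ n\<close> times its second moment and an upper bound for it.\<close>

lemma second_moment_bound:
  assumes n: "n > 0" and roots: "\<And>x. poly (cut_poly n a) x = 0 \<Longrightarrow> x\<^sup>2 \<le> r\<^sup>2"
  shows "(\<Sum>S\<in>Pow {..<n}. \<Sum>i<n. (app S b i)\<^sup>2) \<le> 2 ^ n * (r\<^sup>2 * (\<Sum>i<n. (b i)\<^sup>2))"
proof -
  let ?V = "Pow {..<n}"
  define D where "D S x = minor (pencil (\<lambda>_. x) (signed_cut a S)) {..<n}" for S and x :: real
  define \<delta> where "\<delta> S x = D S x / x ^ n" for S x
  define m where "m = (\<Sum>i<n. (b i)\<^sup>2)"
  define k where "k S = (\<Sum>i<n. b i * app S b i)" for S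
  \<comment> \<open>A solution exists whenever \<open>D S x \<noteq> 0\<close>, hence for all large
    \<open>x\<close>; elsewhere the choice is arbitrary.\<close>
  define u where "u S x = (SOME u. \<forall>i<n. (\<Sum>j<n. pencil (\<lambda>_. x) (signed_cut a S) i j * u j) = b i)"
    for S and x :: real
  define \<phi> where "\<phi> S x = (\<Sum>i<n. b i * u S x i)" for S x
  let ?P = "poly (cut_poly n a)" and ?Q = "poly (border_poly n a b)"
  have \<delta>1: "(\<delta> S \<longlongrightarrow> 1) at_top" and \<delta>2: "((\<lambda>x. x * (\<delta> S x - 1)) \<longlongrightarrow> 0) at_top" for S
    using minor_normalized_tendsto[of S] by (simp_all add: \<delta>_def[abs_def] D_def)
  have D0: "eventually (\<lambda>x. D S x \<noteq> 0) at_top" for S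
    using order_tendstoD(1)[OF \<delta>1, of 0 S] by (auto elim!: eventually_mono simp: \<delta>_def)
  have u: "\<forall>i<n. (\<Sum>j<n. pencil (\<lambda>_. x) (signed_cut a S) i j * u S x j) = b i" if "D S x \<noteq> 0" for S x
  proof -
    have "\<exists>u. \<forall>i<n. (\<Sum>j<n. pencil (\<lambda>_. x) (signed_cut a S) i j * u j) = b i"
      using that unfolding D_def by (rule linear_system_solvable)
    then show ?thesis unfolding u_def by (rule someI_ex)
  qed
  have solve: "eventually (\<lambda>x. \<forall>i<n. x * u S x i - app S (u S x) i = b i) at_top" for S
    using D0[of S] by eventually_elim (use u in \<open>auto simp: pencil_app\<close>)
  have \<phi>3: "((\<lambda>x. x * (x * (x * \<phi> S x)) - x * (x * m) - x * k S) \<longlongrightarrow> (\<Sum>i<n. (app S b i)\<^sup>2)) at_top"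
    and \<phi>1: "((\<lambda>x. x * \<phi> S x) \<longlongrightarrow> m) at_top" for S
    using resolvent_expansion[OF solve[of S]] by (simp_all add: \<phi>_def m_def k_def)
  have "eventually (\<lambda>x. \<forall>S\<in>?V. D S x \<noteq> 0) at_top"
    by (rule eventually_ball_finite) (use D0 in auto)
  then have Q: "eventually (\<lambda>x. ?Q x = (\<Sum>S\<in>?V. D S x * \<phi> S x)) at_top"
  proof eventually_elim
    case (elim x)
    show ?case
      unfolding D_def \<phi>_def by (rule border_poly_resolvent) (use u elim in auto)
  qed
  have P: "?P x = (\<Sum>S\<in>?V. D S x)" for x
    by (simp add: poly_cut_poly cut_sum_def D_def)
  have \<delta>_sum: "((\<lambda>x. \<Sum>S\<in>?V. \<delta> S x) \<longlongrightarrow> 2 ^ n) at_top"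
  proof -
    have "((\<lambda>x. \<Sum>S\<in>?V. \<delta> S x) \<longlongrightarrow> (\<Sum>S\<in>?V. 1)) at_top"
      by (intro tendsto_sum \<delta>1)
    then show ?thesis by (simp add: card_Pow)
  qed
  have scale: "D S x = x ^ n * \<delta> S x" if "x > 0" for S x
    using that by (simp add: \<delta>_def)
  have mean: "((\<lambda>x. x * (?Q x / ?P x)) \<longlongrightarrow> m) at_top"
  proof -
    have "((\<lambda>x. (\<Sum>S\<in>?V. \<delta> S x * (x * \<phi> S x)) / (\<Sum>S\<in>?V. \<delta> S x)) \<longlongrightarrow> (\<Sum>S\<in>?V. 1 * m) / 2 ^ n) at_top"
      by (intro tendsto_divide tendsto_sum tendsto_mult \<delta>1 \<phi>1 \<delta>_sum) simp
    moreover have "(\<Sum>S\<in>?V. 1 * m) / 2 ^ n = m" by (simp add: card_Pow)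
    moreover have "eventually (\<lambda>x. (\<Sum>S\<in>?V. \<delta> S x * (x * \<phi> S x)) / (\<Sum>S\<in>?V. \<delta> S x) =
        x * (?Q x / ?P x)) at_top"
      using Q eventually_gt_at_top[of 0]
    proof eventually_elim
      case (elim x)
      have "?Q x = x ^ n * (\<Sum>S\<in>?V. \<delta> S x * \<phi> S x)" "?P x = x ^ n * (\<Sum>S\<in>?V. \<delta> S x)"
        unfolding elim(1) P using elim(2) by (simp_all add: scale sum_distrib_left mult.assoc)
      moreover have "(\<Sum>S\<in>?V. \<delta> S x * (x * \<phi> S x)) = x * (\<Sum>S\<in>?V. \<delta> S x * \<phi> S x)"
        unfolding sum_distrib_left by (intro sum.cong) auto
      ultimately show ?case using elim(2) by simp
    qed
    ultimately show ?thesis using Lim_transform_eventually by force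
  qed
  have upper: "?Q x / ?P x \<le> m * x / (x\<^sup>2 - r\<^sup>2)" if "x > \<bar>r\<bar>" for x
  proof (rule pick_odd_bound[OF _ _ border_poly_pick border_poly_odd roots mean that])
    show "cut_poly n a \<noteq> 0" "degree (border_poly n a b) < degree (cut_poly n a)"
      using degree_cut_poly degree_border_poly[OF n] by auto
  qed
  \<comment> \<open>This is \<open>x * ((x^2 - r^2) * Q - m * x * P) / x ^ n\<close>, nonpositive by
    \<open>upper\<close>, arranged so that every piece converges. The two terms in
    \<open>k S\<close> add up to \<open>- x * k S\<close>, which vanishes after summation over
    \<open>S\<close>.\<close>
  define G where "G x = (\<Sum>S\<in>?V. \<delta> S x * (x * (x * (x * \<phi> S x)) - x * (x * m) - x * k S) -
    r\<^sup>2 * (\<delta> S x * (x * \<phi> S x)) + x * (\<delta> S x - 1) * k S)" for x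
  have "(G \<longlongrightarrow> (\<Sum>S\<in>?V. 1 * (\<Sum>i<n. (app S b i)\<^sup>2) - r\<^sup>2 * (1 * m) + 0 * k S)) at_top"
    unfolding G_def by (intro tendsto_intros \<delta>1 \<delta>2 \<phi>1 \<phi>3)
  moreover have "eventually (\<lambda>x. G x \<le> 0) at_top"
    using Q eventually_gt_at_top[of "\<bar>r\<bar>"] eventually_gt_at_top[of 0] order_tendstoD(1)[OF \<delta>_sum, of 0, simplified]
  proof eventually_elim
    case (elim x)
    have Px: "?P x = x ^ n * (\<Sum>S\<in>?V. \<delta> S x)" "?Q x = x ^ n * (\<Sum>S\<in>?V. \<delta> S x * \<phi> S x)"
      unfolding elim(1) P using elim(3) by (simp_all add: scale sum_distrib_left mult.assoc)
    have quad: "x\<^sup>2 - r\<^sup>2 > 0"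
      using elim(2) by (metis abs_ge_zero diff_gt_0_iff_gt power2_abs power_strict_mono zero_less_numeral)
    have "?Q x / ?P x = (\<Sum>S\<in>?V. \<delta> S x * \<phi> S x) / (\<Sum>S\<in>?V. \<delta> S x)"
      unfolding Px using elim(3) by simp
    then have "(\<Sum>S\<in>?V. \<delta> S x * \<phi> S x) / (\<Sum>S\<in>?V. \<delta> S x) \<le> m * x / (x\<^sup>2 - r\<^sup>2)"
      using upper[OF elim(2)] by simp
    then have "(x\<^sup>2 - r\<^sup>2) * (\<Sum>S\<in>?V. \<delta> S x * \<phi> S x) \<le> m * x * (\<Sum>S\<in>?V. \<delta> S x)"
      using quad elim(4) by (simp add: divide_le_eq le_divide_eq mult_ac)
    then have "x * ((x\<^sup>2 - r\<^sup>2) * (\<Sum>S\<in>?V. \<delta> S x * \<phi> S x)) \<le> x * (m * x * (\<Sum>S\<in>?V. \<delta> S x))"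
      using elim(3) by (intro mult_left_mono) auto
    moreover have "G x = x * ((x\<^sup>2 - r\<^sup>2) * (\<Sum>S\<in>?V. \<delta> S x * \<phi> S x)) - x * (m * x * (\<Sum>S\<in>?V. \<delta> S x))"
    proof -
      have "G x = (\<Sum>S\<in>?V. x * ((x\<^sup>2 - r\<^sup>2) * (\<delta> S x * \<phi> S x)) - x * (m * x * \<delta> S x) - x * k S)"
        unfolding G_def by (intro sum.cong refl) (simp add: algebra_simps power2_eq_square)
      also have "\<dots> = x * ((x\<^sup>2 - r\<^sup>2) * (\<Sum>S\<in>?V. \<delta> S x * \<phi> S x)) -
          x * (m * x * (\<Sum>S\<in>?V. \<delta> S x)) - x * (\<Sum>S\<in>?V. k S)"
        unfolding sum_subtractf sum_distrib_left ..
      also have "(\<Sum>S\<in>?V. k S) = 0" unfolding k_def by (rule sum_first_moment)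
      finally show ?thesis by simp
    qed
    ultimately show ?case by simp
  qed
  ultimately have "(\<Sum>S\<in>?V. 1 * (\<Sum>i<n. (app S b i)\<^sup>2) - r\<^sup>2 * (1 * m) + 0 * k S) \<le> 0"
    by (rule tendsto_upperbound) simp
  then show ?thesis by (simp add: sum_subtractf card_Pow m_def)
qed

text \<open>\<open>second_moment_bound\<close> with its left side evaluated row by row through
  \<open>sum_app_signed_cut_square\<close>. The second sum is the form of the diagonal of the
  squared matrix.\<close>

lemma quadratic_form_bound:
  assumes "n > 0" "\<And>x. poly (cut_poly n a) x = 0 \<Longrightarrow> x\<^sup>2 \<le> r\<^sup>2"
  shows "(\<Sum>i<n. (\<Sum>j<n. a i j * b j)\<^sup>2) + (\<Sum>i<n. \<Sum>j<n. (a i j)\<^sup>2 * (b j)\<^sup>2) \<le>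
    4 * r\<^sup>2 * (\<Sum>i<n. (b i)\<^sup>2)"
proof -
  let ?l = "(\<Sum>i<n. (\<Sum>j<n. a i j * b j)\<^sup>2) + (\<Sum>i<n. \<Sum>j<n. (a i j)\<^sup>2 * (b j)\<^sup>2)"
  have "2 ^ n / 4 * ?l = (\<Sum>i<n. \<Sum>S\<in>Pow {..<n}. (app S b i)\<^sup>2)"
    unfolding sum.distrib[symmetric] sum_distrib_left app_def
    by (intro sum.cong) (simp_all add: sum_app_signed_cut_square)
  also have "\<dots> \<le> 2 ^ n * (r\<^sup>2 * (\<Sum>i<n. (b i)\<^sup>2))"
    by (subst sum.swap) (rule second_moment_bound[OF assms])
  finally have "2 ^ n * ?l \<le> 2 ^ n * (4 * r\<^sup>2 * (\<Sum>i<n. (b i)\<^sup>2))" by simp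
  then show ?thesis by (subst (asm) mult_le_cancel_left_pos) simp_all
qed

text \<open>The real bound for real and imaginary parts, added up; the spectral radius supplies
  complex eigenvectors.\<close>

lemma complex_quadratic_form_bound:
  fixes w :: "nat \<Rightarrow> complex"
  assumes "n > 0" "\<And>x. poly (cut_poly n a) x = 0 \<Longrightarrow> x\<^sup>2 \<le> r\<^sup>2"
  shows "(\<Sum>i<n. (cmod (\<Sum>j<n. of_real (a i j) * w j))\<^sup>2) + (\<Sum>i<n. \<Sum>j<n. (a i j)\<^sup>2 * (cmod (w j))\<^sup>2) \<le>
    4 * r\<^sup>2 * (\<Sum>i<n. (cmod (w i))\<^sup>2)"
  using quadratic_form_bound[OF assms, of "\<lambda>j. Re (w j)"] quadratic_form_bound[OF assms, of "\<lambda>j. Im (w j)"]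
  by (simp add: cmod_power2 sum.distrib distrib_left)

end

section \<open>Signed regular graphs\<close>

text \<open>\<open>submatrix\<close> renumbers \<open>S\<close> by its increasing enumeration
  \<open>pick S\<close>, which \<open>minor_reindex\<close> undoes.\<close>

lemma char_poly_principal_submatrix:
  assumes A: "A \<in> carrier_mat n n" and S: "S \<subseteq> {..<n}"
  shows "char_poly (principal_submatrix A S) =
    minor (pencil (\<lambda>_. [:0, 1:]) (\<lambda>i j. [:A $$ (i, j):])) S"
proof -
  have set: "{i. i < dim_row A \<and> i \<in> S} = S" "{i. i < dim_col A \<and> i \<in> S} = S" and fin: "finite S"
    using A S by (auto intro: finite_subset)
  have inj: "inj_on (pick S) {..<card S}"
  proof (rule linorder_inj_onI)
    fix i j assume "i < j" "j \<in> {..<card S}"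
    then show "pick S i \<noteq> pick S j" using pick_mono_le[of j S i] by simp
  qed auto
  have img: "pick S ` {..<card S} = S"
    using card_image[OF inj] pick_in_set_le by (intro card_subset_eq fin) auto
  have "char_poly (principal_submatrix A S) =
      minor (pencil (\<lambda>_. [:0, 1:]) (\<lambda>i j. [:A $$ (pick S i, pick S j):])) {..<card S}"
    by (simp add: principal_submatrix_def submatrix_def set minor_pencil_char_poly)
  also have "\<dots> = minor (\<lambda>i j. pencil (\<lambda>_. [:0, 1:]) (\<lambda>i j. [:A $$ (i, j):]) (pick S i) (pick S j)) {..<card S}"
    using inj by (intro minor_cong) (auto simp: pencil_def inj_on_eq_iff)
  also have "\<dots> = minor (pencil (\<lambda>_. [:0, 1:]) (\<lambda>i j. [:A $$ (i, j):])) S"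
    using minor_reindex[OF finite_lessThan inj] img by metis
  finally show ?thesis .
qed

lemma mixed_det_poly_eq_cut_poly:
  assumes A: "A \<in> carrier_mat n n"
  shows "mixed_det_poly A (- A) = smult (1 / 2 ^ n) (cut_poly n (\<lambda>i j. A $$ (i, j)))"
proof -
  have "char_poly (principal_submatrix A S) * char_poly (principal_submatrix (- A) ({..<n} - S)) =
      minor (pencil (\<lambda>_. [:0, 1:]) (signed_cut (\<lambda>i j. [:A $$ (i, j):]) S)) {..<n}" if "S \<subseteq> {..<n}" for S
  proof -
    have "char_poly (principal_submatrix (- A) ({..<n} - S)) =
        minor (pencil (\<lambda>_. [:0, 1:]) (\<lambda>i j. [:(- A) $$ (i, j):])) ({..<n} - S)"
      by (rule char_poly_principal_submatrix) (use A in auto)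
    also have "\<dots> = minor (pencil (\<lambda>_. [:0, 1:]) (\<lambda>i j. - [:A $$ (i, j):])) ({..<n} - S)"
      using A by (intro minor_cong) (auto simp: pencil_def)
    finally show ?thesis
      unfolding minor_pencil_cut[OF that] using char_poly_principal_submatrix[OF A that] by simp
  qed
  then show ?thesis
    using A by (simp add: mixed_det_poly_def Let_def cut_poly_def cut_sum_def)
qed

text \<open>The roots are symmetric about 0 by \<open>cut_sum_uminus\<close>, so the largest one
  bounds them all in absolute value.\<close>

lemma cut_poly_root_bound:
  assumes A: "A \<in> carrier_mat n n" and root: "poly (cut_poly n (\<lambda>i j. A $$ (i, j))) x = 0"
  shows "x\<^sup>2 \<le> (largest_mixed_root A)\<^sup>2"
proof -
  let ?p = "cut_poly n (\<lambda>i j. A $$ (i, j))"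
  have set: "{x. poly (mixed_det_poly A (- A)) x = 0} = {x. poly ?p x = 0}"
    unfolding mixed_det_poly_eq_cut_poly[OF A] by simp
  have "poly ?p (- x) = 0"
    using root cut_sum_uminus[of n "\<lambda>_. x"] by (simp add: poly_cut_poly)
  moreover have "finite {x. poly ?p x = 0}"
    by (rule poly_roots_finite) (rule degree_cut_poly)
  ultimately have "x \<le> largest_mixed_root A" "- x \<le> largest_mixed_root A"
    using root by (auto simp: largest_mixed_root_def set)
  then show ?thesis by (intro abs_le_square_iff[THEN iffD1]) linarith
qed

text \<open>Edges at \<open>j\<close> correspond to their other endpoints; edges have two elements,
  so no loop spoils the bijection.\<close>

lemma degree_count:
  assumes G: "regular_graph n E d" and j: "j < n"
  shows "(\<Sum>i<n. of_bool ({i, j} \<in> E)) = (of_nat d :: real)"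
proof -
  have simple: "e \<subseteq> {..<n} \<and> card e = 2" if "e \<in> E" for e
    using G that by (auto simp: regular_graph_def simple_graph_def)
  have "bij_betw (\<lambda>i. {i, j}) {i. i < n \<and> {i, j} \<in> E} {e \<in> E. j \<in> e}"
    unfolding bij_betw_def
  proof (intro conjI inj_onI equalityI subsetI)
    fix e assume "e \<in> {e \<in> E. j \<in> e}"
    then have e: "e \<in> E" "j \<in> e" by auto
    then obtain i where "e = {i, j}" using simple[OF e(1)] by (auto simp: card_2_iff insert_commute)
    then show "e \<in> (\<lambda>i. {i, j}) ` {i. i < n \<and> {i, j} \<in> E}" using e simple[OF e(1)] by auto
  qed (auto simp: doubleton_eq_iff)
  then have "card {i. i < n \<and> {i, j} \<in> E} = card {e \<in> E. j \<in> e}" by (rule bij_betw_same_card)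
  also have "\<dots> = d" using G j by (auto simp: regular_graph_def)
  finally have "card ({..<n} \<inter> {i. {i, j} \<in> E}) = d" by (simp add: Int_def)
  then show ?thesis by (simp add: sum_of_bool_eq)
qed

theorem corollary5p1:
  fixes n d :: nat and E :: "nat set set" and \<sigma> :: "nat set \<Rightarrow> real" and A :: "real mat"
  assumes "n \<ge> 1" and "d \<ge> 2"
    and "regular_graph n E d"
    and "edge_signing E \<sigma>"
    and "A = signed_adjacency n E \<sigma>"
    and "(largest_mixed_root A)\<^sup>2 \<le> 2 * (real d - 1)"
  shows "rho A \<le> sqrt (7 * real d - 8) \<and>
         sqrt (7 * real d - 8) < sqrt 7 * sqrt (real d - 1)"
proof
  show "sqrt (7 * real d - 8) < sqrt 7 * sqrt (real d - 1)"
    unfolding real_sqrt_mult[symmetric] by (rule real_sqrt_less_mono) simp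
  have A: "A \<in> carrier_mat n n" using assms(5) by (simp add: signed_adjacency_def)
  define a where "a i j = A $$ (i, j)" for i j
  define r where "r = largest_mixed_root A"
  have entry: "a i j = (if {i, j} \<in> E then \<sigma> {i, j} else 0)" if "i < n" "j < n" for i j
    using that by (simp add: a_def assms(5) signed_adjacency_def)
  have no_loop: "{i} \<notin> E" for i
    using assms(3) by (auto simp: regular_graph_def simple_graph_def)
  have square: "(a i j)\<^sup>2 = of_bool ({i, j} \<in> E)" if "i < n" "j < n" for i j
    using assms(4) by (auto simp: entry[OF that] edge_signing_def power2_eq_1_iff)
  interpret symmetric_form n a
    by unfold_locales (use no_loop in \<open>auto simp: entry insert_commute\<close>)
  have roots: "x\<^sup>2 \<le> r\<^sup>2" if "poly (cut_poly n a) x = 0" for x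
    using cut_poly_root_bound[OF A] that by (simp add: a_def[abs_def] r_def)
  let ?C = "map_mat complex_of_real A"
  have C: "?C \<in> carrier_mat n n" using A by simp
  \<comment> \<open>The spectral radius is attained, the matrix being nonempty as
    \<open>n \<ge> 1\<close>.\<close>
  obtain \<mu> where \<mu>: "\<mu> \<in> spectrum ?C" "rho A = cmod \<mu>"
    using spectral_radius_mem_max(1)[OF C] assms(1) by (auto simp: rho_def)
  then obtain v where v: "v \<in> carrier_vec n" "v \<noteq> 0\<^sub>v n" "?C *\<^sub>v v = \<mu> \<cdot>\<^sub>v v"
    using A by (auto simp: spectrum_def eigenvalue_def eigenvector_def)
  define N where "N = (\<Sum>i<n. (cmod (v $ i))\<^sup>2)"
  have "N > 0"
  proof -
    obtain i where "i < n" "v $ i \<noteq> 0" using v(1,2) by (auto simp: vec_eq_iff)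
    then show ?thesis unfolding N_def by (intro sum_pos2[of _ i]) auto
  qed
  have eigen: "(\<Sum>j<n. of_real (a i j) * v $ j) = \<mu> * v $ i" if i: "i < n" for i
  proof -
    have "(\<Sum>j<n. of_real (a i j) * v $ j) = (?C *\<^sub>v v) $ i"
      using A v(1) i by (simp add: scalar_prod_def lessThan_atLeast0 a_def)
    then show ?thesis using v(1,3) i by simp
  qed
  \<comment> \<open>Squared entries indicate edges, so every column sum is \<open>d\<close>; the
    diagonal part of the bound thus adds exactly \<open>d * N\<close>.\<close>
  have column: "(\<Sum>i<n. (a i j)\<^sup>2 * c) = real d * c" if "j < n" for j c
  proof -
    have "(\<Sum>i<n. (a i j)\<^sup>2 * c) = (\<Sum>i<n. of_bool ({i, j} \<in> E)) * c"
      unfolding sum_distrib_right by (intro sum.cong) (use that square in auto)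
    then show ?thesis using degree_count[OF assms(3) that] by simp
  qed
  have "(\<Sum>i<n. \<Sum>j<n. (a i j)\<^sup>2 * (cmod (v $ j))\<^sup>2) = (\<Sum>j<n. real d * (cmod (v $ j))\<^sup>2)"
    by (subst sum.swap, intro sum.cong refl) (simp only: column lessThan_iff)
  then have "(cmod \<mu>)\<^sup>2 * N + real d * N \<le> 4 * r\<^sup>2 * N"
    using complex_quadratic_form_bound[OF _ roots, of "\<lambda>j. v $ j"] assms(1)
    by (simp add: eigen norm_mult power_mult_distrib sum_distrib_left[symmetric] N_def)
  then have "((cmod \<mu>)\<^sup>2 + real d) * N \<le> 4 * r\<^sup>2 * N" by (simp add: distrib_right)
  then have "(cmod \<mu>)\<^sup>2 + real d \<le> 4 * r\<^sup>2" using \<open>N > 0\<close> by (simp only: mult_le_cancel_right_pos)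
  \<comment> \<open>\<open>4 * 2 * (d - 1) - d = 7 * d - 8\<close>.\<close>
  then have "(rho A)\<^sup>2 \<le> 7 * real d - 8" using assms(6) \<mu>(2) by (simp add: r_def)
  then show "rho A \<le> sqrt (7 * real d - 8)" by (rule real_le_rsqrt)
qed

end
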